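(* Assume that the characteristic of $\mathbb{F}_q$ is not equal to $2$ or $3$. Then, for $q \ge 504$, the number $I_4$ of consecutive irreducible polynomial sequences of length $4$ over $\mathbb{F}_q$ satisfies $$I_4 \ge \frac{1}{24} (q-1)^2 (q - 22 \sqrt{q} - 10) (q^2 - 2q\sqrt{q} - 18q + 18 \sqrt{q} +57).$$
   Context: $\mathbb{F}_q$ is the finite field with $q$ elements. A consecutive irreducible polynomial sequence of length $N$ over $\mathbb{F}_q$ is a sequence $f_1,\ldots,f_N$ with $f_n=u_nX^n+\cdots+u_1X+u_0\in\mathbb{F}_q[X]$, where $u_0,u_1,\ldots,u_N$ are non-zero elements of $\mathbb{F}_q$, such that every $f_n$ ($1\le n\le N$) is irreducible over $\mathbb{F}_q$. $I_N$ denotes the number of such sequences (equivalently, of such tuples $(u_0,\ldots,u_N)$). *)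

theory Defs
  imports "HOL-Computational_Algebra.Computational_Algebra" "HOL-Library.Cardinality"
begin

text \<open>
  The list \<open>fs = [f\<^sub>1, \<dots>, f\<^sub>N]\<close> is indexed from \<open>0\<close>, so \<open>f\<^sub>n\<close> is \<open>fs ! (n - 1)\<close>.
  The coefficients \<open>u\<^sub>0, \<dots>, u\<^sub>N\<close> are the values of \<open>u\<close> on \<open>{0..N}\<close>; its values elsewhere are irrelevant.
\<close>

definition consecutive_irreducible_seq :: "nat \<Rightarrow> 'a::finite_field poly list \<Rightarrow> bool" where
  "consecutive_irreducible_seq N fs \<longleftrightarrow>
     length fs = N \<and>
     (\<exists>u :: nat \<Rightarrow> 'a.
        (\<forall>i\<in>{0..N}. u i \<noteq> 0) \<and>
        (\<forall>n\<in>{1..N}. fs ! (n - 1) = (\<Sum>i=0..n. monom (u i) i))) \<and>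
     (\<forall>n\<in>{1..N}. irreducible (fs ! (n - 1)))"

definition num_consecutive_irreducible_seqs :: "'a::finite_field itself \<Rightarrow> nat \<Rightarrow> nat" where
  "num_consecutive_irreducible_seqs TYPE('a) N =
     card {fs :: 'a poly list. consecutive_irreducible_seq N fs}"

end

(*
  Scaling the polynomials and the variable reduces the count to u_0 = u_1 = 1, at the price of a
  factor (q-1)^2; after reversal one needs the triples (u, v, a) for which X^2+X+u, X^3+X^2+uX+v and
  X^4+X^3+uX^2+vX+a are irreducible. The pairs (u, v) good for the first two polynomials are counted
  up to O(q) by counting roots and pairs of roots of the cubic, the latter being points of a conic.
  For fixed (u, v), the number of good a is expressed through the factorizations into
  (X^2-sX+p)(X^2-s'X+p') with s + s' = -1: here p and p' are affine functions of (u, v) for each s,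
  and counting roots, pairs of roots and factorizations shows that the number is at least (q - 7 +
  2A - B)/4, where A and B are the sums over s of chi(D_s) and chi(D_s D_s'), with chi the quadratic
  character and D_s = s^2 - 4p. No Weil bound is needed for these sums, because it suffices to bound
  them on average over (u, v): the zero sets of the D_s are lines with distinct directions, no four
  of which are concurrent, so the second moments of A and B over the whole plane are at most q^3 and
  5q^3.
*)
theory Submission
  imports Defs
begin

section \<open>The quadratic character\<close>

text \<open>After reversal each polynomial is X times the previous one plus a new constant term.
  With the earlier coefficients fixed, the roots for all choices of that constant form the fibres of
  one polynomial map, so numbers of roots and of pairs of roots can be summed over the constant, and
  the indicator of irreducibility is bounded below by a combination of such counts. The 24 is 2 * 3
  * 4, from the densities 1/2, 1/3 and 1/4 of irreducible polynomials of degree 2, 3 and 4.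

  The obstacle is that, for fixed (u, v), A and B are up to sign character sums of polynomials of
  degree 4 and 6 in s, for which elementary means give no pointwise bound. Nor can cancellation be
  expected in their plain sum over the good pairs, a set without linear structure. Squares are
  nonnegative, however, so a second moment over the good pairs is at most the one over the whole
  plane, where exchanging the sums leaves sums over (u, v) of products of affine forms. With r =
  sqrt q and leading term q^3, the resulting loss is 12 q^2 r, while the claimed bound gives away 24
  q^2 r; the difference absorbs all lower terms.\<close>

definition quad_char :: "'a::finite_field \<Rightarrow> real" where
  "quad_char x = (if x = 0 then 0 else if \<exists>y. y\<^sup>2 = x then 1 else - 1)"

lemma quad_char_0 [simp]: "quad_char 0 = 0"
  by (simp add: quad_char_def)

lemma quad_char_square: "y \<noteq> 0 \<Longrightarrow> quad_char (y\<^sup>2) = 1"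
  by (auto simp: quad_char_def)

lemma quad_char_eq_0_iff [simp]: "quad_char x = 0 \<longleftrightarrow> x = 0"
  by (simp add: quad_char_def)

lemma quad_char_cases:
  obtains "quad_char x = 0" "x = 0" | "quad_char x = 1" "x \<noteq> 0" | "quad_char x = - 1" "x \<noteq> 0"
  by (cases "x = 0"; cases "\<exists>y. y\<^sup>2 = x") (auto simp: quad_char_def)

lemma quad_char_eq_1_iff: "quad_char x = 1 \<longleftrightarrow> x \<noteq> 0 \<and> (\<exists>y. y\<^sup>2 = x)"
  by (simp add: quad_char_def)

lemma abs_quad_char_le: "\<bar>quad_char x\<bar> \<le> 1"
  by (cases x rule: quad_char_cases) auto

lemma quad_char_power2: "(quad_char x)\<^sup>2 = of_bool (x \<noteq> 0)"
  by (cases x rule: quad_char_cases) auto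

lemma card_sqrt_eq:
  fixes x :: "'a::finite_field"
  assumes two: "(2::'a) \<noteq> 0"
  shows "real (card {y. y\<^sup>2 = x}) = 1 + quad_char x"
proof (cases "x \<noteq> 0 \<and> (\<exists>y. y\<^sup>2 = x)")
  case True
  then obtain z where z: "z\<^sup>2 = x" "z \<noteq> 0" by auto
  have "{y. y\<^sup>2 = x} = {z, - z}"
    using z by (auto simp: power2_eq_iff)
  moreover have "z \<noteq> - z"
  proof
    assume "z = - z"
    then have "2 * z = 0" by (metis add.right_inverse mult_2)
    with two z show False by simp
  qed
  ultimately show ?thesis
    using z quad_char_square by (metis card_2_iff of_nat_numeral one_add_one)
next
  case False
  show ?thesis
  proof (cases "x = 0")
    case False
    then have no_sqrt: "{y. y\<^sup>2 = x} = {}"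
      using \<open>\<not> (x \<noteq> 0 \<and> (\<exists>y. y\<^sup>2 = x))\<close> by auto
    then show ?thesis
      using False by (auto simp: quad_char_def)
  qed simp
qed

lemma sum_card_fibres:
  fixes f :: "'b::finite \<Rightarrow> 'c::finite"
  shows "(\<Sum>v\<in>UNIV. card {x. f x = v}) = CARD('b)"
proof -
  have "(\<Sum>v\<in>UNIV. card {x. f x = v}) = card (\<Union>v\<in>UNIV. {x. f x = v})"
    by (subst card_UN_disjoint) auto
  also have "(\<Union>v\<in>UNIV. {x. f x = v}) = UNIV" by auto
  finally show ?thesis .
qed

lemma sum_quad_char:
  assumes two: "(2::'a::finite_field) \<noteq> 0"
  shows "(\<Sum>x\<in>UNIV. quad_char (x::'a)) = 0"
proof -
  have "real CARD('a) = (\<Sum>x\<in>UNIV. real (card {y::'a. y\<^sup>2 = x}))"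
    using sum_card_fibres[of "\<lambda>y::'a. y\<^sup>2"] by (metis of_nat_sum)
  also have "\<dots> = (\<Sum>x\<in>(UNIV::'a set). 1 + quad_char x)"
    by (intro sum.cong) (auto simp: card_sqrt_eq[OF two])
  also have "\<dots> = real CARD('a) + (\<Sum>x\<in>(UNIV::'a set). quad_char x)"
    by (simp add: sum.distrib)
  finally show ?thesis by simp
qed

lemma bij_affine:
  assumes "(a::'a::field) \<noteq> 0"
  shows "bij (\<lambda>x. a * x + b)"
  by (rule bij_betw_byWitness[where f' = "\<lambda>y. (y - b) / a"]) (use assms in auto)

lemma sum_quad_char_affine:
  fixes a b :: "'a::finite_field"
  assumes "(2::'a) \<noteq> 0" "a \<noteq> 0"
  shows "(\<Sum>x\<in>UNIV. quad_char (a * x + b)) = 0"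
  using sum.reindex_bij_betw[OF bij_affine[of a b], of quad_char] sum_quad_char assms by simp

lemma quad_char_mult_square:
  fixes x :: "'a::finite_field"
  assumes "y \<noteq> 0"
  shows "quad_char (y\<^sup>2 * x) = quad_char x"
proof -
  have "(\<exists>z. z\<^sup>2 = y\<^sup>2 * x) \<longleftrightarrow> (\<exists>z. z\<^sup>2 = x)"
  proof
    assume "\<exists>z. z\<^sup>2 = y\<^sup>2 * x"
    then obtain z where "z\<^sup>2 = y\<^sup>2 * x" ..
    then have "(z / y)\<^sup>2 = x" using assms by (simp add: power_divide)
    then show "\<exists>z. z\<^sup>2 = x" ..
  qed (metis power_mult_distrib)
  then show ?thesis using assms by (simp add: quad_char_def)
qed

text \<open>A counting argument instead of a generator of the unit group: multiplication by the
  nonsquare \<open>a\<close> sends nonzero squares to nonsquares, contributing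
  \<open>- card ?S\<close> to a character sum that vanishes. The nonsquares are equally many, so
  they must all contribute their maximal value 1.\<close>

lemma quad_char_mult_nonsquares:
  fixes a b :: "'a::finite_field"
  assumes two: "(2::'a) \<noteq> 0" and a: "quad_char a = - 1" and b: "quad_char b = - 1"
  shows "quad_char (a * b) = 1"
proof -
  have a0: "a \<noteq> 0" using a by auto
  let ?S = "{x::'a. quad_char x = 1}" and ?N = "{x::'a. quad_char x = - 1}"
  have split: "(\<Sum>x\<in>UNIV. g x) = g 0 + (\<Sum>x\<in>?S. g x) + (\<Sum>x\<in>?N. g x)" for g :: "'a \<Rightarrow> real"
  proof -
    have "(UNIV::'a set) = insert 0 (?S \<union> ?N)"
      using quad_char_cases by blast
    then have "(\<Sum>x\<in>UNIV. g x) = (\<Sum>x\<in>insert 0 (?S \<union> ?N). g x)" by simp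
    also have "\<dots> = g 0 + (\<Sum>x\<in>?S \<union> ?N. g x)"
      by (subst sum.insert) auto
    also have "(\<Sum>x\<in>?S \<union> ?N. g x) = (\<Sum>x\<in>?S. g x) + (\<Sum>x\<in>?N. g x)"
      by (rule sum.union_disjoint) auto
    finally show ?thesis by simp
  qed
  have card_eq: "real (card ?S) = real (card ?N)"
    using split[of quad_char] sum_quad_char[OF two] by simp
  have S: "quad_char (a * x) = - 1" if "x \<in> ?S" for x
  proof -
    have "x \<noteq> 0 \<and> (\<exists>y. y\<^sup>2 = x)"
      using that by (simp add: quad_char_eq_1_iff)
    then obtain y where "y\<^sup>2 = x" "x \<noteq> 0" by blast
    then show ?thesis
      using quad_char_mult_square[of y a] a by (auto simp: mult.commute)
  qed
  have "0 = (\<Sum>x\<in>?S. quad_char (a * x)) + (\<Sum>x\<in>?N. quad_char (a * x))"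
    using split[of "\<lambda>x. quad_char (a * x)"] sum_quad_char_affine[OF two a0, of 0] by simp
  also have "(\<Sum>x\<in>?S. quad_char (a * x)) = - real (card ?S)"
    using S by simp
  finally have "(\<Sum>x\<in>?N. 1 - quad_char (a * x)) = 0"
    using card_eq by (simp add: sum_subtractf)
  moreover have "1 - quad_char (a * x) \<ge> 0" for x
    using abs_quad_char_le[of "a * x"] by linarith
  ultimately have "\<forall>x\<in>?N. 1 - quad_char (a * x) = 0"
    by (subst (asm) sum_nonneg_eq_0_iff) auto
  then show ?thesis using b by simp
qed

lemma quad_char_mult:
  fixes a b :: "'a::finite_field"
  assumes two: "(2::'a) \<noteq> 0"
  shows "quad_char (a * b) = quad_char a * quad_char b"
proof -
  have square: "quad_char (x * y) = quad_char x * quad_char y" if x: "quad_char x = 1" for x y :: 'a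
  proof -
    obtain z where "z\<^sup>2 = x" "z \<noteq> 0"
      using x by (auto simp: quad_char_eq_1_iff)
    then show ?thesis using quad_char_mult_square[of z y] x by auto
  qed
  show ?thesis
  proof (cases a rule: quad_char_cases)
    case 3
    note a = 3
    show ?thesis
    proof (cases b rule: quad_char_cases)
      case 2
      then show ?thesis using square[of b a] by (simp add: mult.commute)
    next
      case 3
      then show ?thesis using quad_char_mult_nonsquares[OF two] a by simp
    qed simp
  qed (auto simp: square)
qed

section \<open>Character sums of quadratic polynomials\<close>

lemma four_neq_0:
  assumes "(2::'a::field) \<noteq> 0"
  shows "(4::'a) \<noteq> 0"
  using assms by (metis mult_2 mult_eq_0_iff numeral_Bit0)

text \<open>The sum measures the points of the hyperbola \<open>y\<^sup>2 = x\<^sup>2 - d\<close>.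
  Writing it as (x + y)(x - y) = d, the points are parametrized by m = x + y \<noteq> 0 with x - y =
  d / m, so there are q - 1 of them.\<close>

lemma sum_quad_char_square_minus:
  fixes d :: "'a::finite_field"
  assumes two: "(2::'a) \<noteq> 0" and d: "d \<noteq> 0"
  shows "(\<Sum>x\<in>UNIV. quad_char (x\<^sup>2 - d)) = - 1"
proof -
  let ?P = "Sigma UNIV (\<lambda>x. {y::'a. y\<^sup>2 = x\<^sup>2 - d})"
  have "bij_betw (\<lambda>m. ((m + d / m) / 2, (m - d / m) / 2)) (UNIV - {0}) ?P"
  proof (rule bij_betw_byWitness[where f' = "\<lambda>(x, y). x + y"])
    show "\<forall>m\<in>UNIV - {0}. (\<lambda>(x, y). x + y) ((m + d / m) / 2, (m - d / m) / 2) = m"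
    proof -
      have "(m + w) / 2 + (m - w) / 2 = m" for m w :: 'a
        using two by (simp flip: add_divide_distrib mult_2)
      then show ?thesis by simp
    qed
    have sum_ne: "x + y \<noteq> 0" and quot: "d / (x + y) = x - y" if "y\<^sup>2 = x\<^sup>2 - d" for x y :: 'a
    proof -
      have eq: "(x + y) * (x - y) = d" using that by (simp add: algebra_simps power2_eq_square)
      then show ne: "x + y \<noteq> 0" using d by auto
      then show "d / (x + y) = x - y" using eq by (simp add: field_simps)
    qed
    have "(x + y + (x - y)) / 2 = x" "(x + y - (x - y)) / 2 = y" for x y :: 'a
      using two by (auto simp: field_simps)
    then show "\<forall>p\<in>?P. (\<lambda>m. ((m + d / m) / 2, (m - d / m) / 2)) ((\<lambda>(x, y). x + y) p) = p"
      by (auto simp: quot)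
    show "(\<lambda>(x, y). x + y) ` ?P \<subseteq> UNIV - {0}"
      using sum_ne by auto
    have "((m - d / m) / 2)\<^sup>2 = ((m + d / m) / 2)\<^sup>2 - d" if "m \<noteq> 0" for m
    proof -
      have "(m - d / m)\<^sup>2 = (m + d / m)\<^sup>2 - 4 * d"
        using that by (simp add: field_simps power2_eq_square)
      then have "((m - d / m) / 2)\<^sup>2 = ((m + d / m)\<^sup>2 - 4 * d) / 4"
        by (simp add: power_divide)
      also have "\<dots> = (m + d / m)\<^sup>2 / 4 - d"
        using four_neq_0[OF two] by (simp add: diff_divide_distrib)
      finally show ?thesis by (simp add: power_divide)
    qed
    then show "(\<lambda>m. ((m + d / m) / 2, (m - d / m) / 2)) ` (UNIV - {0}) \<subseteq> ?P"
      by auto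
  qed
  then have "card ?P = CARD('a) - 1"
    using bij_betw_same_card[of _ "UNIV - {0::'a}" ?P] card_Diff_singleton[OF UNIV_I, of "0::'a"]
    by force
  moreover have "card ?P = (\<Sum>x\<in>UNIV. card {y::'a. y\<^sup>2 = x\<^sup>2 - d})"
    by (rule card_SigmaI) auto
  ultimately have "real (CARD('a) - 1) = (\<Sum>x\<in>UNIV. real (card {y::'a. y\<^sup>2 = x\<^sup>2 - d}))"
    by (metis of_nat_sum)
  also have "\<dots> = (\<Sum>x\<in>(UNIV::'a set). 1 + quad_char (x\<^sup>2 - d))"
    by (intro sum.cong) (auto simp: card_sqrt_eq[OF two])
  also have "\<dots> = real CARD('a) + (\<Sum>x\<in>(UNIV::'a set). quad_char (x\<^sup>2 - d))"
    by (simp add: sum.distrib)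
  finally show ?thesis by (simp add: of_nat_diff)
qed

lemma sum_quad_char_quadratic:
  fixes a b c :: "'a::finite_field"
  assumes two: "(2::'a) \<noteq> 0" and a: "a \<noteq> 0" and disc: "b\<^sup>2 - 4 * a * c \<noteq> 0"
  shows "(\<Sum>x\<in>UNIV. quad_char (a * x\<^sup>2 + b * x + c)) = - quad_char a"
proof -
  let ?d = "(b\<^sup>2 - 4 * a * c) / (2 * a)\<^sup>2"
  have "a * x\<^sup>2 + b * x + c = a * ((1 * x + b / (2 * a))\<^sup>2 - ?d)" for x
  proof -
    have "(2 * a)\<^sup>2 * ((1 * x + b / (2 * a))\<^sup>2 - ?d) = (2 * a * (x + b / (2 * a)))\<^sup>2 - (b\<^sup>2 - 4 * a * c)"
      using two four_neq_0[OF two] a by (simp only: right_diff_distrib power_mult_distrib) simp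
    also have "2 * a * (x + b / (2 * a)) = 2 * a * x + b"
      using two a by (simp add: distrib_left)
    also have "(2 * a * x + b)\<^sup>2 - (b\<^sup>2 - 4 * a * c) = 4 * a * (a * x\<^sup>2 + b * x + c)"
      by (simp add: algebra_simps power2_eq_square)
    finally have "4 * a * (a * ((1 * x + b / (2 * a))\<^sup>2 - ?d)) = 4 * a * (a * x\<^sup>2 + b * x + c)"
      by (simp add: power2_eq_square mult.assoc)
    moreover have "4 * a \<noteq> 0"
      using four_neq_0[OF two] a by simp
    ultimately show ?thesis by (metis mult_left_cancel)
  qed
  then have "(\<Sum>x\<in>UNIV. quad_char (a * x\<^sup>2 + b * x + c))
      = quad_char a * (\<Sum>x\<in>UNIV. quad_char ((1 * x + b / (2 * a))\<^sup>2 - ?d))"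
    by (simp only: quad_char_mult[OF two] sum_distrib_left)
  also have "(\<Sum>x\<in>UNIV. quad_char ((1 * x + b / (2 * a))\<^sup>2 - ?d)) = (\<Sum>x\<in>UNIV. quad_char (x\<^sup>2 - ?d))"
    by (rule sum.reindex_bij_betw[OF bij_affine, where g = "\<lambda>x. quad_char (x\<^sup>2 - ?d)"]) simp
  also have "\<dots> = - 1"
    using two four_neq_0[OF two] a disc by (intro sum_quad_char_square_minus) auto
  finally show ?thesis by simp
qed

text \<open>The discriminant of the product is the square of \<open>a * d - b * c\<close>. If one
  factor is constant, the product is a nonconstant affine function or zero, and the sum
  vanishes.\<close>

lemma abs_sum_quad_char_two_affine_le:
  fixes a b c d :: "'a::finite_field"
  assumes two: "(2::'a) \<noteq> 0" and ne: "a * d \<noteq> b * c"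
  shows "\<bar>\<Sum>x\<in>UNIV. quad_char ((a * x + c) * (b * x + d))\<bar> \<le> 1"
proof (cases "a = 0 \<or> b = 0")
  case True
  have affine_times_const: "(\<Sum>x\<in>UNIV. quad_char (k * (l * x + m))) = 0" if "l \<noteq> 0" for k l m :: 'a
    using sum_quad_char_affine[OF two that, of m]
    by (simp add: quad_char_mult[OF two] flip: sum_distrib_left)
  show ?thesis
  proof (cases "a = 0")
    case True
    then show ?thesis using affine_times_const[of b c d] ne by auto
  next
    case False
    then have "b = 0" using True by simp
    then show ?thesis using affine_times_const[of a d c] False by (auto simp: mult.commute)
  qed
next
  case False
  have "(a * d + b * c)\<^sup>2 - 4 * (a * b) * (c * d) = (a * d - b * c)\<^sup>2"
    by (simp add: algebra_simps power2_eq_square)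
  then have "(a * d + b * c)\<^sup>2 - 4 * (a * b) * (c * d) \<noteq> 0"
    using ne by simp
  then have "(\<Sum>x\<in>UNIV. quad_char (a * b * x\<^sup>2 + (a * d + b * c) * x + c * d)) = - quad_char (a * b)"
    using False two by (intro sum_quad_char_quadratic) auto
  moreover have "a * b * x\<^sup>2 + (a * d + b * c) * x + c * d = (a * x + c) * (b * x + d)" for x
    by (simp add: algebra_simps power2_eq_square)
  ultimately show ?thesis using abs_quad_char_le[of "a * b"] by simp
qed

section \<open>Character sums over lines in the plane\<close>

text \<open>
  Sum over the lines \<open>y = m x\<close> through the origin: on each of them the argument is, up to a square, a constant
  times a quadratic polynomial, whose discriminant vanishes for at most one \<open>m\<close>.
\<close>
lemma abs_sum_quad_char_plane_le:
  fixes a b c a' b' c' :: "'a::finite_field"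
  assumes two: "(2::'a) \<noteq> 0" and indep: "a * b' \<noteq> a' * b" and ne: "c \<noteq> 0 \<or> c' \<noteq> 0"
  shows "\<bar>\<Sum>x\<in>UNIV. \<Sum>y\<in>UNIV. quad_char (x * y * ((a * x + b * y + c) * (a' * x + b' * y + c')))\<bar>
    \<le> 3 * real CARD('a)"
proof -
  let ?q = "real CARD('a)"
  let ?h = "\<lambda>m x. quad_char (((a + b * m) * x + c) * ((a' + b' * m) * x + c'))"
  let ?g = "\<lambda>m. \<Sum>x\<in>UNIV - {0}. ?h m x"
  let ?f = "\<lambda>x y. quad_char (x * y * ((a * x + b * y + c) * (a' * x + b' * y + c')))"
  \<comment> \<open>For \<open>m\<close> in \<open>E\<close> the two affine factors in
    \<open>x\<close> are proportional, so their product may be a constant times a square and only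
    the trivial bound is available.\<close>
  define E where "E = {m. (a + b * m) * c' = (a' + b' * m) * c}"
  have "(\<Sum>x\<in>UNIV. \<Sum>y\<in>UNIV. ?f x y) = (\<Sum>x\<in>UNIV - {0}. \<Sum>y\<in>UNIV. ?f x y)"
    by (simp add: sum.remove[of UNIV 0])
  also have "\<dots> = (\<Sum>x\<in>UNIV - {0}. \<Sum>m\<in>UNIV. quad_char m * ?h m x)"
  proof (rule sum.cong[OF refl])
    fix x :: 'a assume x: "x \<in> UNIV - {0}"
    then have "(\<Sum>y\<in>UNIV. ?f x y) = (\<Sum>m\<in>UNIV. ?f x (x * m + 0))"
      by (intro sum.reindex_bij_betw[OF bij_affine, symmetric]) simp
    also have "\<dots> = (\<Sum>m\<in>UNIV. quad_char m * ?h m x)"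
    proof (rule sum.cong[OF refl])
      fix m :: 'a
      have "x * (x * m + 0) * ((a * x + b * (x * m + 0) + c) * (a' * x + b' * (x * m + 0) + c'))
        = x\<^sup>2 * (m * (((a + b * m) * x + c) * ((a' + b' * m) * x + c')))"
        by (simp add: algebra_simps power2_eq_square)
      moreover have "x \<noteq> 0" using x by simp
      ultimately show "?f x (x * m + 0) = quad_char m * ?h m x"
        by (simp only: quad_char_mult_square quad_char_mult[OF two, of m] not_False_eq_True)
    qed
    finally show "(\<Sum>y\<in>UNIV. ?f x y) = (\<Sum>m\<in>UNIV. quad_char m * ?h m x)" .
  qed
  also have "\<dots> = (\<Sum>m\<in>UNIV. quad_char m * ?g m)"
    by (subst sum.swap) (simp add: sum_distrib_left)
  finally have "\<bar>\<Sum>x\<in>UNIV. \<Sum>y\<in>UNIV. ?f x y\<bar> = \<bar>\<Sum>m\<in>UNIV. quad_char m * ?g m\<bar>"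
    by simp
  also have "\<dots> \<le> (\<Sum>m\<in>UNIV. \<bar>?g m\<bar>)"
  proof (rule order.trans[OF sum_abs sum_mono])
    fix m :: 'a
    show "\<bar>quad_char m * ?g m\<bar> \<le> \<bar>?g m\<bar>"
      using mult_right_mono[OF abs_quad_char_le[of m], of "\<bar>?g m\<bar>"] by (simp add: abs_mult)
  qed
  \<comment> \<open>Of the 2, one unit bounds the sum over all \<open>x\<close>, the other the
    omitted term \<open>x = 0\<close>.\<close>
  also have "\<dots> \<le> (\<Sum>m\<in>UNIV. 2 + ?q * of_bool (m \<in> E))"
  proof (rule sum_mono)
    fix m :: 'a
    show "\<bar>?g m\<bar> \<le> 2 + ?q * of_bool (m \<in> E)"
    proof (cases "m \<in> E")
      case True
      have "\<bar>?g m\<bar> \<le> (\<Sum>x\<in>UNIV - {0::'a}. 1)"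
        by (rule order.trans[OF sum_abs sum_mono]) (rule abs_quad_char_le)
      also have "\<dots> \<le> ?q" by simp
      finally show ?thesis using True by simp
    next
      case False
      then have "\<bar>\<Sum>x\<in>UNIV. ?h m x\<bar> \<le> 1"
        unfolding E_def by (intro abs_sum_quad_char_two_affine_le[OF two]) simp
      moreover have "(\<Sum>x\<in>UNIV. ?h m x) = quad_char (c * c') + ?g m"
        by (subst sum.remove[of UNIV 0]) auto
      ultimately show ?thesis
        using abs_quad_char_le[of "c * c'"] False by auto
    qed
  qed
  also have "\<dots> = 2 * ?q + ?q * real (card E)"
    by (simp add: sum.distrib flip: sum_distrib_left)
  \<comment> \<open>Membership in \<open>E\<close> is a linear equation in \<open>m\<close>. Two
    solutions would make both of its coefficients vanish, and then \<open>indep\<close> would force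
    \<open>c\<close> and \<open>c'\<close> to be zero.\<close>
  also have "card E \<le> 1"
  proof -
    have "m = n" if "m \<in> E" "n \<in> E" for m n
    proof (rule ccontr)
      assume "m \<noteq> n"
      have m: "(a * c' - a' * c) + m * (b * c' - b' * c) = 0"
        and n: "(a * c' - a' * c) + n * (b * c' - b' * c) = 0"
        using that by (auto simp: E_def algebra_simps)
      have "(m - n) * (b * c' - b' * c) = 0"
        using m n by (metis add_left_cancel left_diff_distrib right_minus_eq)
      then have b: "b * c' = b' * c" using \<open>m \<noteq> n\<close> by simp
      then have a: "a * c' = a' * c" using m by simp
      have "(a * b' - a' * b) * c = 0" "(a * b' - a' * b) * c' = 0"
        using a b by algebra+
      then show False using indep ne by auto
    qed
    then show ?thesis by (auto simp: card_le_Suc0_iff_eq)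
  qed
  finally show ?thesis
    by (simp add: mult_left_mono)
qed

text \<open>Lines of different slopes are not parallel, so their two affine forms can replace
  \<open>u\<close> and \<open>v\<close> as coordinates of the plane.\<close>

lemma bij_line_coordinates:
  fixes s t k l :: "'a::field"
  assumes "s \<noteq> t"
  shows "bij (\<lambda>(u, v). (u * s + v + k, u * t + v + l))"
proof (rule bij_betw_byWitness[where
      f' = "\<lambda>(x, y). let u = ((x - k) - (y - l)) / (s - t) in (u, x - k - u * s)"])
  have "u * s + v - (u * t + v) = u * (s - t)" for u v :: 'a
    by (simp add: algebra_simps)
  then show "\<forall>p\<in>UNIV. (\<lambda>(x, y). let u = ((x - k) - (y - l)) / (s - t) in (u, x - k - u * s))
      ((\<lambda>(u, v). (u * s + v + k, u * t + v + l)) p) = p"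
    using assms by (auto simp: Let_def)
  have "z / (s - t) * t + (x - k - z / (s - t) * s) + l = y" if "z = (x - k) - (y - l)" for x y z :: 'a
  proof -
    have "z / (s - t) * s - z / (s - t) * t = z"
      using assms by (simp only: right_diff_distrib[symmetric]) simp
    then have "z / (s - t) * t = z / (s - t) * s - z" by (metis diff_diff_eq2 add_diff_cancel_left')
    then show ?thesis using that by simp
  qed
  then show "\<forall>p\<in>UNIV. (\<lambda>(u, v). (u * s + v + k, u * t + v + l))
      ((\<lambda>(x, y). let u = ((x - k) - (y - l)) / (s - t) in (u, x - k - u * s)) p) = p"
    by (auto simp: Let_def)
qed auto

lemma sum_quad_char_two_lines:
  fixes s t k l :: "'a::finite_field"
  assumes two: "(2::'a) \<noteq> 0" and "s \<noteq> t"
  shows "(\<Sum>(u, v)\<in>UNIV. quad_char (u * s + v + k) * quad_char (u * t + v + l)) = 0"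
proof -
  have "(\<Sum>(u, v)\<in>UNIV. quad_char (u * s + v + k) * quad_char (u * t + v + l))
    = (\<Sum>(x, y)\<in>UNIV. quad_char (x::'a) * quad_char (y::'a))"
    using sum.reindex_bij_betw[OF bij_line_coordinates[OF assms(2), of k l],
        of "\<lambda>(x, y). quad_char x * quad_char y"]
    by (simp add: case_prod_beta)
  also have "\<dots> = (\<Sum>x\<in>UNIV. quad_char (x::'a)) * (\<Sum>y\<in>UNIV. quad_char (y::'a))"
    by (simp add: sum_product sum.cartesian_product)
  finally show ?thesis using sum_quad_char[OF two] by simp
qed

lemma abs_sum_quad_char_four_lines_le:
  fixes s1 s2 s3 s4 k1 k2 k3 k4 :: "'a::finite_field"
  assumes two: "(2::'a) \<noteq> 0" and "s1 \<noteq> s2" "s3 \<noteq> s4"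
    and not_concurrent: "\<And>u v. \<not> (u * s1 + v + k1 = 0 \<and> u * s2 + v + k2 = 0 \<and>
      u * s3 + v + k3 = 0 \<and> u * s4 + v + k4 = 0)"
  shows "\<bar>\<Sum>(u, v)\<in>UNIV. quad_char ((u * s1 + v + k1) * (u * s2 + v + k2) *
      ((u * s3 + v + k3) * (u * s4 + v + k4)))\<bar> \<le> 3 * real CARD('a)"
proof -
  \<comment> \<open>Interpolation weights: \<open>s\<close> is the affine combination of
    \<open>s1\<close> and \<open>s2\<close> with coefficients \<open>a s\<close> and
    \<open>b s\<close>. This expresses every further form through the first two, which become the
    coordinates \<open>x\<close> and \<open>y\<close>.\<close>
  define a b where "a = (\<lambda>s. (s - s2) / (s1 - s2))" and "b = (\<lambda>s. (s1 - s) / (s1 - s2))"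
  have s: "s1 - s2 \<noteq> 0" using assms by simp
  have ab: "a s + b s = 1" "a s * s1 + b s * s2 = s" for s
  proof -
    have "a s + b s = ((s - s2) + (s1 - s)) / (s1 - s2)"
      by (simp only: a_def b_def add_divide_distrib)
    also have "(s - s2) + (s1 - s) = s1 - s2" by simp
    finally show "a s + b s = 1" using s by simp
    have "a s * s1 + b s * s2 = ((s - s2) * s1 + (s1 - s) * s2) / (s1 - s2)"
      by (simp add: a_def b_def add_divide_distrib)
    also have "(s - s2) * s1 + (s1 - s) * s2 = s * (s1 - s2)"
      by (simp add: algebra_simps)
    finally show "a s * s1 + b s * s2 = s" using s by simp
  qed
  define c where "c = (\<lambda>s k. k - a s * k1 - b s * k2)"
  have line: "a s * (u * s1 + v + k1) + b s * (u * s2 + v + k2) + c s k = u * s + v + k" for s k u v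
  proof -
    have "a s * (u * s1 + v + k1) + b s * (u * s2 + v + k2) + c s k
      = u * (a s * s1 + b s * s2) + (a s + b s) * v + k"
      by (simp add: c_def algebra_simps)
    then show ?thesis using ab by simp
  qed
  have "(\<Sum>(u, v)\<in>UNIV. quad_char ((u * s1 + v + k1) * (u * s2 + v + k2) *
      ((u * s3 + v + k3) * (u * s4 + v + k4))))
    = (\<Sum>(x, y)\<in>UNIV. quad_char (x * y *
      ((a s3 * x + b s3 * y + c s3 k3) * (a s4 * x + b s4 * y + c s4 k4))))"
    using sum.reindex_bij_betw[OF bij_line_coordinates[OF assms(2), of k1 k2],
        of "\<lambda>(x, y). quad_char (x * y *
      ((a s3 * x + b s3 * y + c s3 k3) * (a s4 * x + b s4 * y + c s4 k4)))"]
    by (simp add: case_prod_beta line)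
  also have "\<dots> = (\<Sum>x\<in>UNIV. \<Sum>y\<in>UNIV. quad_char (x * y *
      ((a s3 * x + b s3 * y + c s3 k3) * (a s4 * x + b s4 * y + c s4 k4))))"
    by (simp add: sum.cartesian_product)
  also have "\<bar>\<dots>\<bar> \<le> 3 * real CARD('a)"
  proof (rule abs_sum_quad_char_plane_le[OF two])
    show "a s3 * b s4 \<noteq> a s4 * b s3"
    proof
      assume "a s3 * b s4 = a s4 * b s3"
      then have "a s3 = a s4"
        using ab(1)[of s3] ab(1)[of s4] by algebra
      then have "s3 = s4" using s by (simp add: a_def)
      then show False using assms by simp
    qed
    \<comment> \<open>At the common point of the first two lines the other two forms take the
      constant values \<open>c s3 k3\<close> and \<open>c s4 k4\<close>, so these vanish together
      only if all four lines are concurrent.\<close>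
    obtain u v where uv: "u * s1 + v + k1 = 0" "u * s2 + v + k2 = 0"
      using bij_line_coordinates[OF assms(2), of k1 k2] unfolding bij_def surj_def
      by (metis (mono_tags, lifting) case_prod_beta prod.inject)
    then have "u * s + v + k = c s k" for s k
      using line[of s u v k] by simp
    then show "c s3 k3 \<noteq> 0 \<or> c s4 k4 \<noteq> 0"
      using not_concurrent[of u v] uv by auto
  qed
  finally show ?thesis .
qed

text \<open>
  Up to a nonzero constant depending on \<open>s\<close>, this is the discriminant of the factor \<open>X\<^sup>2 - s X + p\<close> of a
  quartic \<open>X\<^sup>4 + X\<^sup>3 + u X\<^sup>2 + v X + a\<close>, see \<open>factor_disc_eq_disc_line\<close>. As a function of \<open>s\<close> it is cubic,
  so at most three of these lines meet in a point.
\<close>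
definition disc_line :: "'a::field \<Rightarrow> 'a \<times> 'a \<Rightarrow> 'a" where
  "disc_line s = (\<lambda>(u, v). u * s + v + (2 * s ^ 3 + 3 * s\<^sup>2) / 4)"

lemma card_disc_line_zeros_le:
  fixes p :: "'a::finite_field \<times> 'a"
  assumes two: "(2::'a) \<noteq> 0"
  shows "card {s. disc_line s p = 0} \<le> 3"
proof -
  obtain u v where p: "p = (u, v)" by (cases p)
  let ?P = "[:v, u, 3 / 4, 2 / 4:]"
  have zeros: "{s. disc_line s p = 0} = {s. poly ?P s = 0}"
    by (auto simp: disc_line_def p algebra_simps power2_eq_square power3_eq_cube add_divide_distrib)
  have "card {s. poly ?P s = 0} \<le> degree ?P"
    using two four_neq_0[OF two] by (intro card_poly_roots_bound) auto
  also have "\<dots> \<le> 3" by simp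
  finally show ?thesis unfolding zeros .
qed

section \<open>Second moments over the plane\<close>

lemma sum_square_expand:
  fixes f :: "'b \<Rightarrow> 'c \<Rightarrow> real"
  shows "(\<Sum>p\<in>P. (\<Sum>s\<in>T. f s p)\<^sup>2) = (\<Sum>s\<in>T. \<Sum>t\<in>T. \<Sum>p\<in>P. f s p * f t p)"
proof -
  have "(\<Sum>p\<in>P. (\<Sum>s\<in>T. f s p)\<^sup>2) = (\<Sum>p\<in>P. \<Sum>s\<in>T. \<Sum>t\<in>T. f s p * f t p)"
    by (simp add: power2_eq_square sum_product)
  also have "\<dots> = (\<Sum>s\<in>T. \<Sum>p\<in>P. \<Sum>t\<in>T. f s p * f t p)"
    by (rule sum.swap)
  also have "\<dots> = (\<Sum>s\<in>T. \<Sum>t\<in>T. \<Sum>p\<in>P. f s p * f t p)"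
    by (rule sum.cong[OF refl]) (rule sum.swap)
  finally show ?thesis .
qed

lemma sum_le_CARD_square:
  fixes f :: "'a::finite \<times> 'a \<Rightarrow> real"
  assumes "\<And>p. f p \<le> 1"
  shows "(\<Sum>p\<in>UNIV. f p) \<le> (real CARD('a))\<^sup>2"
proof -
  have "(\<Sum>p\<in>UNIV. f p) \<le> (\<Sum>p\<in>(UNIV::('a \<times> 'a) set). 1)"
    by (rule sum_mono) (rule assms)
  then show ?thesis by (simp add: power2_eq_square)
qed

text \<open>Forms with different \<open>s\<close> are orthogonal, so only the diagonal survives: at
  most q values of \<open>s\<close>, each contributing at most q^2. The weights \<open>w\<close>
  make room for the factors relating \<open>disc_line\<close> to the actual discriminants.\<close>

lemma second_moment_disc_lines:
  fixes w :: "'a::finite_field \<Rightarrow> real" and T :: "'a set"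
  assumes two: "(2::'a) \<noteq> 0" and w: "\<And>s. \<bar>w s\<bar> \<le> 1"
  shows "(\<Sum>p\<in>UNIV. (\<Sum>s\<in>T. w s * quad_char (disc_line s p))\<^sup>2) \<le> real CARD('a) ^ 3"
proof -
  let ?q = "real CARD('a)"
  let ?f = "\<lambda>s p. w s * quad_char (disc_line s p)"
  have "(\<Sum>p\<in>UNIV. (\<Sum>s\<in>T. ?f s p)\<^sup>2) = (\<Sum>s\<in>T. \<Sum>t\<in>T. \<Sum>p\<in>UNIV. ?f s p * ?f t p)"
    by (rule sum_square_expand)
  also have "\<dots> \<le> (\<Sum>s\<in>T. \<Sum>t\<in>T. if s = t then ?q\<^sup>2 else 0)"
  proof (intro sum_mono)
    fix s t
    show "(\<Sum>p\<in>UNIV. ?f s p * ?f t p) \<le> (if s = t then ?q\<^sup>2 else 0)"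
    proof (cases "s = t")
      case True
      have "(?f s p)\<^sup>2 \<le> 1" for p
        using mult_mono[OF w[of s] abs_quad_char_le[of "disc_line s p"]]
        by (intro iffD2[OF abs_square_le_1]) (simp add: abs_mult)
      then show ?thesis
        using True by (auto simp: power2_eq_square intro!: sum_le_CARD_square[unfolded power2_eq_square])
    next
      case False
      have "(\<Sum>p\<in>UNIV. ?f s p * ?f t p)
        = w s * w t * (\<Sum>p\<in>UNIV. quad_char (disc_line s p) * quad_char (disc_line t p))"
        by (simp add: sum_distrib_left algebra_simps)
      also have "\<dots> = 0"
        using sum_quad_char_two_lines[OF two False] by (simp add: disc_line_def case_prod_beta)
      finally show ?thesis using False by simp
    qed
  qed
  also have "\<dots> = real (card T) * ?q\<^sup>2"
    by simp
  also have "\<dots> \<le> ?q * ?q\<^sup>2"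
    by (intro mult_right_mono) (auto intro: card_mono)
  finally show ?thesis by (simp add: power3_eq_cube power2_eq_square)
qed

text \<open>The 5 is 2 + 3. For each \<open>s\<close> the two values \<open>t = s\<close> and
  \<open>t = - 1 - s\<close> give the same product of lines and cost q^2 apiece, in total 2 q^3. The
  other at most q^2 pairs involve four distinct lines, which are not concurrent, and cost 3 q
  each.\<close>

lemma second_moment_disc_line_pairs:
  fixes T :: "'a::finite_field set"
  assumes two: "(2::'a) \<noteq> 0" and T: "\<And>s. s \<in> T \<Longrightarrow> s \<noteq> - 1 - s"
  shows "(\<Sum>p\<in>UNIV. (\<Sum>s\<in>T. quad_char (disc_line s p * disc_line (- 1 - s) p))\<^sup>2) \<le> 5 * real CARD('a) ^ 3"
proof -
  let ?q = "real CARD('a)"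
  let ?f = "\<lambda>s p. quad_char (disc_line s p * disc_line (- 1 - s) p)"
  have q: "real (card T) \<le> ?q"
    by (auto intro: card_mono)
  have "(\<Sum>p\<in>UNIV. (\<Sum>s\<in>T. ?f s p)\<^sup>2) = (\<Sum>s\<in>T. \<Sum>t\<in>T. \<Sum>p\<in>UNIV. ?f s p * ?f t p)"
    by (rule sum_square_expand)
  also have "\<dots> \<le> (\<Sum>s\<in>T. \<Sum>t\<in>T. 3 * ?q + ?q\<^sup>2 * of_bool (t \<in> {s, - 1 - s}))"
  proof (intro sum_mono)
    fix s t assume s: "s \<in> T" and t: "t \<in> T"
    have mult: "?f s p * ?f t p = quad_char (disc_line s p * disc_line (- 1 - s) p *
        (disc_line t p * disc_line (- 1 - t) p))" for p
      by (simp add: quad_char_mult[OF two])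
    show "(\<Sum>p\<in>UNIV. ?f s p * ?f t p) \<le> 3 * ?q + ?q\<^sup>2 * of_bool (t \<in> {s, - 1 - s})"
    proof (cases "t \<in> {s, - 1 - s}")
      case True
      have "(\<Sum>p\<in>UNIV. ?f s p * ?f t p) \<le> ?q\<^sup>2"
      proof (rule sum_le_CARD_square)
        fix p
        show "?f s p * ?f t p \<le> 1"
          unfolding mult using abs_quad_char_le abs_le_D1 by blast
      qed
      moreover have "0 \<le> ?q" by simp
      ultimately show ?thesis using True by auto
    next
      case False
      have distinct: "card {s, - 1 - s, t, - 1 - t} = 4"
      proof -
        have "s \<noteq> - 1 - t"
        proof
          assume "s = - 1 - t"
          then have "t = - 1 - s" by simp
          then show False using False by simp
        qed
        moreover have "t \<noteq> s" "t \<noteq> - 1 - s"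
          using False by simp_all
        ultimately have "distinct [s, - 1 - s, t, - 1 - t]"
          using T[OF s] T[OF t] by auto
        from distinct_card[OF this] show ?thesis by simp
      qed
      have "\<bar>\<Sum>p\<in>UNIV. ?f s p * ?f t p\<bar> \<le> 3 * ?q"
        unfolding mult unfolding disc_line_def case_prod_beta
      proof (rule abs_sum_quad_char_four_lines_le[OF two T[OF s] T[OF t], unfolded case_prod_beta])
        fix u v
        have "\<not> {s, - 1 - s, t, - 1 - t} \<subseteq> {s. disc_line s (u, v) = 0}"
        proof
          assume "{s, - 1 - s, t, - 1 - t} \<subseteq> {s. disc_line s (u, v) = 0}"
          then have "card {s, - 1 - s, t, - 1 - t} \<le> card {s. disc_line s (u, v) = 0}"
            by (rule card_mono[rotated]) simp
          then show False
            using distinct card_disc_line_zeros_le[OF two, of "(u, v)"] by linarith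
        qed
        then show "\<not> (u * s + v + (2 * s ^ 3 + 3 * s\<^sup>2) / 4 = 0 \<and>
          u * (- 1 - s) + v + (2 * (- 1 - s) ^ 3 + 3 * (- 1 - s)\<^sup>2) / 4 = 0 \<and>
          u * t + v + (2 * t ^ 3 + 3 * t\<^sup>2) / 4 = 0 \<and>
          u * (- 1 - t) + v + (2 * (- 1 - t) ^ 3 + 3 * (- 1 - t)\<^sup>2) / 4 = 0)"
          by (simp add: disc_line_def)
      qed
      then show ?thesis using False by auto
    qed
  qed
  also have "\<dots> \<le> (\<Sum>s\<in>T. 3 * ?q * ?q + ?q\<^sup>2 * 2)"
  proof (rule sum_mono)
    fix s
    have "card (T \<inter> {s, - 1 - s}) \<le> card {s, - 1 - s}"
      by (rule card_mono) auto
    also have "\<dots> \<le> 2"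
      by (simp add: card_insert_if)
    finally have "real (card (T \<inter> {s, - 1 - s})) \<le> 2" by simp
    then have "?q\<^sup>2 * real (card (T \<inter> {s, - 1 - s})) \<le> ?q\<^sup>2 * 2"
      by (intro mult_left_mono) auto
    moreover have "3 * ?q * real (card T) \<le> 3 * ?q * ?q"
      using q by (intro mult_left_mono) auto
    moreover have sum_E: "(\<Sum>t\<in>T. 3 * ?q + ?q\<^sup>2 * of_bool (t \<in> E))
      = 3 * ?q * real (card T) + ?q\<^sup>2 * real (card (T \<inter> E))" for E
      by (simp add: sum.distrib Int_def flip: sum_distrib_left)
    ultimately show "(\<Sum>t\<in>T. 3 * ?q + ?q\<^sup>2 * of_bool (t \<in> {s, - 1 - s})) \<le> 3 * ?q * ?q + ?q\<^sup>2 * 2"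
      using sum_E[of "{s, - 1 - s}"] by linarith
  qed
  also have "\<dots> = real (card T) * (5 * ?q\<^sup>2)"
    by (simp add: power2_eq_square algebra_simps)
  also have "\<dots> \<le> ?q * (5 * ?q\<^sup>2)"
    using q by (intro mult_right_mono) auto
  finally show ?thesis by (simp add: power3_eq_cube power2_eq_square algebra_simps)
qed

section \<open>Counting roots and pairs of roots\<close>

lemma sum_collisions:
  fixes f :: "'b::finite \<Rightarrow> 'c::finite"
  shows "(\<Sum>v\<in>UNIV. real (card {x. f x = v}) * (real (card {x. f x = v}) - 1))
    = real (card {(x, y). x \<noteq> y \<and> f x = f y})"
proof -
  have "{(x, y). x \<noteq> y \<and> f x = f y} = Sigma UNIV (\<lambda>x. {y. f y = f x} - {x})"
    by auto
  then have "real (card {(x, y). x \<noteq> y \<and> f x = f y}) = (\<Sum>x\<in>UNIV. real (card ({y. f y = f x} - {x})))"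
    by (simp add: card_SigmaI)
  also have "\<dots> = (\<Sum>x\<in>UNIV. real (card {y. f y = f x}) - 1)"
  proof (rule sum.cong[OF refl])
    fix x
    have "x \<in> {y. f y = f x}" by simp
    then have "card {y. f y = f x} = Suc (card ({y. f y = f x} - {x}))"
      by (metis card_Suc_Diff1 finite)
    then show "real (card ({y. f y = f x} - {x})) = real (card {y. f y = f x}) - 1" by simp
  qed
  also have "\<dots> = (\<Sum>v\<in>UNIV. \<Sum>x | x \<in> UNIV \<and> f x = v. real (card {y. f y = f x}) - 1)"
    by (rule sum.group[symmetric]) auto
  also have "\<dots> = (\<Sum>v\<in>UNIV. real (card {x. f x = v}) * (real (card {x. f x = v}) - 1))"
    by (intro sum.cong[OF refl]) simp
  finally show ?thesis ..
qed

text \<open>Here \<open>y\<close> will be a difference of two roots, so \<open>y = 0\<close> is left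
  out: only pairs of distinct roots are counted.\<close>

lemma card_nonzero_sqrt_eq:
  fixes x :: "'a::finite_field"
  assumes two: "(2::'a) \<noteq> 0"
  shows "real (card {y. y \<noteq> 0 \<and> y\<^sup>2 = x}) = of_bool (x \<noteq> 0) + quad_char x"
proof (cases "x = 0")
  case False
  then have "{y. y \<noteq> 0 \<and> y\<^sup>2 = x} = {y. y\<^sup>2 = x}" by auto
  then show ?thesis using card_sqrt_eq[OF two, of x] False by simp
qed auto

text \<open>In odd characteristic a pair is determined by its sum \<open>s\<close> and its
  difference \<open>d\<close>, and \<open>d\<^sup>2\<close> is the discriminant of the quadratic
  polynomial with sum \<open>s\<close> and product \<open>p s\<close>.\<close>

lemma card_pairs_with_product:
  fixes p :: "'a::finite_field \<Rightarrow> 'a"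
  assumes two: "(2::'a) \<noteq> 0"
  shows "real (card {(x, y). x \<noteq> y \<and> x + y \<in> T \<and> x * y = p (x + y)})
    = (\<Sum>s\<in>T. of_bool (s\<^sup>2 - 4 * p s \<noteq> 0) + quad_char (s\<^sup>2 - 4 * p s))"
proof -
  let ?P = "{(x, y). x \<noteq> y \<and> x + y \<in> T \<and> x * y = p (x + y)}"
  let ?S = "Sigma T (\<lambda>s. {d. d \<noteq> 0 \<and> d\<^sup>2 = s\<^sup>2 - 4 * p s})"
  have halves: "(s + d) / 2 + (s - d) / 2 = s" "(s + d) / 2 - (s - d) / 2 = d" for s d :: 'a
  proof -
    have "(s + d) / 2 + (s - d) / 2 = (2 * s) / 2"
      by (simp only: add_divide_distrib[symmetric] mult_2) simp
    then show "(s + d) / 2 + (s - d) / 2 = s" using two by simp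
    have "(s + d) / 2 - (s - d) / 2 = (2 * d) / 2"
      by (simp only: diff_divide_distrib[symmetric] mult_2) simp
    then show "(s + d) / 2 - (s - d) / 2 = d" using two by simp
  qed
  have halves': "(x + y + (x - y)) / 2 = x" "(x + y - (x - y)) / 2 = y" for x y :: 'a
  proof -
    have "x + y + (x - y) = 2 * x" "x + y - (x - y) = 2 * y" by simp_all
    then show "(x + y + (x - y)) / 2 = x" "(x + y - (x - y)) / 2 = y" using two by simp_all
  qed
  have prod: "(s + d) / 2 * ((s - d) / 2) = p s" if "d\<^sup>2 = s\<^sup>2 - 4 * p s" for s d
  proof -
    have "(s + d) * (s - d) = 4 * p s"
      using that by (simp add: algebra_simps power2_eq_square)
    then show ?thesis using four_neq_0[OF two] by simp
  qed
  have "bij_betw (\<lambda>(s, d). ((s + d) / 2, (s - d) / 2)) ?S ?P"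
  proof (rule bij_betw_byWitness[where f' = "\<lambda>(x, y). (x + y, x - y)"])
    show "(\<lambda>(s, d). ((s + d) / 2, (s - d) / 2)) ` ?S \<subseteq> ?P"
    proof clarify
      fix s d assume sd: "s \<in> T" "d \<noteq> 0" "d\<^sup>2 = s\<^sup>2 - 4 * p s"
      then show "(s + d) / 2 \<noteq> (s - d) / 2 \<and> (s + d) / 2 + (s - d) / 2 \<in> T \<and>
          (s + d) / 2 * ((s - d) / 2) = p ((s + d) / 2 + (s - d) / 2)"
        using halves[of s d] prod[of d s] by (metis diff_self)
    qed
    have "(x - y)\<^sup>2 = (x + y)\<^sup>2 - 4 * (x * y)" for x y :: 'a
      by (simp add: algebra_simps power2_eq_square)
    then show "(\<lambda>(x, y). (x + y, x - y)) ` ?P \<subseteq> ?S"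
      by auto
  qed (auto simp: halves halves' two)
  then have "card ?P = card ?S"
    using bij_betw_same_card by force
  also have "\<dots> = (\<Sum>s\<in>T. card {d. d \<noteq> 0 \<and> d\<^sup>2 = s\<^sup>2 - 4 * p s})"
    by (rule card_SigmaI) auto
  finally have "real (card ?P) = (\<Sum>s\<in>T. real (card {d. d \<noteq> 0 \<and> d\<^sup>2 = s\<^sup>2 - 4 * p s}))"
    by simp
  then show ?thesis
    by (simp only: card_nonzero_sqrt_eq[OF two])
qed

text \<open>The wanted \<open>v\<close> are the values missed by \<open>?f\<close>, whose fibres
  have k \<le> 3 elements. The indicator of k = 0 is at least 1 - k + k(k - 1)/3, with equality
  unless k = 2, the case of a double root. In the sum over \<open>v\<close> the first two terms
  cancel, and the collisions number at least q - 3: up to 2 are lost at zeros of \<open>?D\<close>,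
  and 1 to the character sum.\<close>

lemma card_rootless_cubics_ge:
  fixes u :: "'a::finite_field"
  assumes two: "(2::'a) \<noteq> 0" and three: "(3::'a) \<noteq> 0" and u: "3 * u \<noteq> 1"
  shows "real (card {v. \<forall>x. x ^ 3 + x\<^sup>2 + u * x + v \<noteq> 0}) \<ge> (real CARD('a) - 3) / 3"
proof -
  let ?q = "real CARD('a)"
  let ?f = "\<lambda>x. - (x ^ 3 + x\<^sup>2 + u * x)"
  let ?k = "\<lambda>v. real (card {x. ?f x = v})"
  let ?D = "\<lambda>s. s\<^sup>2 - 4 * (s\<^sup>2 + s + u)"
  have D: "?D s = - 3 * s\<^sup>2 + - 4 * s + - 4 * u" for s
    by (simp add: algebra_simps)
  have root: "?f x = v \<longleftrightarrow> x ^ 3 + x\<^sup>2 + u * x + v = 0" for x v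
    by (metis add.commute add_eq_0_iff)
  have "card {s. poly [:- 4 * u, - 4, - 3:] s = 0} \<le> degree [:- 4 * u, - 4, - 3:]"
    using three by (intro card_poly_roots_bound) auto
  also have "\<dots> \<le> 2" by simp
  also have "{s. poly [:- 4 * u, - 4, - 3:] s = 0} = {s. ?D s = 0}"
    unfolding D by (auto simp: algebra_simps power2_eq_square)
  finally have card_zeros: "real (card {s. ?D s = 0}) \<le> 2" by simp
  have "(\<Sum>s\<in>(UNIV::'a set). of_bool (?D s \<noteq> 0)) = ?q - real (card {s. ?D s = 0})"
    by (simp only: of_bool_not_iff sum_subtractf) simp
  moreover have "(\<Sum>s\<in>UNIV. quad_char (?D s)) = - quad_char (- 3 :: 'a)"
    unfolding D
  proof (rule sum_quad_char_quadratic[OF two])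
    have "(- 4)\<^sup>2 - 4 * (- 3) * (- 4 * u) = 4 * 4 * (1 - 3 * u)"
      by (simp add: algebra_simps power2_eq_square)
    also have "\<dots> \<noteq> 0"
      using four_neq_0[OF two] u by (intro no_zero_divisors) auto
    finally show "(- 4)\<^sup>2 - 4 * (- 3) * (- 4 * u) \<noteq> 0" .
  qed (use three in simp)
  ultimately have pairs: "(\<Sum>s\<in>UNIV. of_bool (?D s \<noteq> 0) + quad_char (?D s)) \<ge> ?q - 3"
    using card_zeros abs_quad_char_le[of "- 3 :: 'a"] by (simp add: sum.distrib)
  \<comment> \<open>Cancelling y - x leaves a conic, on which the product of two colliding points is
    a function of their sum.\<close>
  have collision: "x \<noteq> y \<and> ?f x = ?f y \<longleftrightarrow> x \<noteq> y \<and> x + y \<in> UNIV \<and> x * y = (x + y)\<^sup>2 + (x + y) + u" for x y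
  proof -
    have "?f x - ?f y = (y - x) * ((x + y)\<^sup>2 + (x + y) + u - x * y)"
      by (simp add: algebra_simps power2_eq_square power3_eq_cube)
    then have "?f x - ?f y = 0 \<longleftrightarrow> x = y \<or> x * y = (x + y)\<^sup>2 + (x + y) + u"
      by (simp only: mult_eq_0_iff right_minus_eq) auto
    then show ?thesis by (simp only: right_minus_eq) blast
  qed
  have "(\<Sum>v\<in>UNIV. ?k v * (?k v - 1)) = real (card {(x, y). x \<noteq> y \<and> ?f x = ?f y})"
    by (rule sum_collisions)
  also have "\<dots> \<ge> ?q - 3"
    unfolding collision card_pairs_with_product[OF two, where p = "\<lambda>s. s\<^sup>2 + s + u"] by (rule pairs)
  finally have "(\<Sum>v\<in>UNIV. ?k v * (?k v - 1)) \<ge> ?q - 3" .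
  moreover have "(\<Sum>v\<in>UNIV. ?k v) = ?q"
    by (simp only: sum_card_fibres flip: of_nat_sum)
  ultimately have "(\<Sum>v\<in>UNIV. 1 - ?k v + ?k v * (?k v - 1) / 3) \<ge> (?q - 3) / 3"
    by (simp add: sum.distrib sum_subtractf flip: sum_divide_distrib)
  also have "(\<Sum>v\<in>UNIV. 1 - ?k v + ?k v * (?k v - 1) / 3)
      \<le> (\<Sum>v\<in>UNIV. of_bool (\<forall>x. x ^ 3 + x\<^sup>2 + u * x + v \<noteq> 0))"
  proof (rule sum_mono)
    fix v
    have "card {x. poly [:v, u, 1, 1:] x = 0} \<le> degree [:v, u, 1, 1:]"
      by (intro card_poly_roots_bound) auto
    also have "\<dots> = 3" by simp
    also have "{x. poly [:v, u, 1, 1:] x = 0} = {x. ?f x = v}"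
      unfolding root by (auto simp: algebra_simps power2_eq_square power3_eq_cube)
    finally have le: "card {x. ?f x = v} \<le> 3" .
    have iff: "(\<forall>x. x ^ 3 + x\<^sup>2 + u * x + v \<noteq> 0) \<longleftrightarrow> card {x. ?f x = v} = 0"
      unfolding root by auto
    have indicator: "1 - real n + real n * (real n - 1) / 3 \<le> of_bool P" if "n \<le> 3" "P \<longleftrightarrow> n = 0" for n P
    proof -
      consider "n = 0" | "n = 1" | "n = 2" | "n = 3" using \<open>n \<le> 3\<close> by linarith
      then show ?thesis using that by cases auto
    qed
    show "1 - ?k v + ?k v * (?k v - 1) / 3 \<le> of_bool (\<forall>x. x ^ 3 + x\<^sup>2 + u * x + v \<noteq> 0)"
      by (rule indicator[OF le iff])
  qed
  also have "\<dots> = real (card {v. \<forall>x. x ^ 3 + x\<^sup>2 + u * x + v \<noteq> 0})"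
    by simp
  finally show ?thesis .
qed

section \<open>Factorizations of quartics\<close>

text \<open>
  The coefficients of \<open>X\<^sup>2\<close> and \<open>X\<close> determine the constant term of a factor \<open>X\<^sup>2 - s X + p\<close> of
  \<open>X\<^sup>4 + X\<^sup>3 + u X\<^sup>2 + v X + a\<close>, independently of \<open>a\<close>. For \<open>s = - 1 / 2\<close> the division gives the junk
  value \<open>0\<close>; no factor with this \<open>s\<close> exists when \<open>8 v - 4 u + 1 \<noteq> 0\<close>.
\<close>
definition factor_const :: "'a::field \<Rightarrow> 'a \<Rightarrow> 'a \<Rightarrow> 'a" where
  "factor_const u v s = (s ^ 3 + s\<^sup>2 + u * s + v) / (2 * s + 1)"

definition factor_disc :: "'a::field \<Rightarrow> 'a \<Rightarrow> 'a \<Rightarrow> 'a" where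
  "factor_disc u v s = s\<^sup>2 - 4 * factor_const u v s"

lemma factor_const_eq:
  assumes "2 * s + 1 \<noteq> 0"
  shows "(2 * s + 1) * factor_const u v s = s ^ 3 + s\<^sup>2 + u * s + v"
  using assms by (simp add: factor_const_def)

lemma complementary_sum_neq:
  fixes s :: "'a::field"
  assumes "2 * s + 1 \<noteq> 0"
  shows "2 * (- 1 - s) + 1 \<noteq> 0" "s \<noteq> - 1 - s"
proof -
  have *: "2 * (- 1 - s) + 1 = - (2 * s + 1)" by (simp add: algebra_simps)
  show "2 * (- 1 - s) + 1 \<noteq> 0" using assms unfolding * by (metis neg_equal_0_iff_equal)
  show "s \<noteq> - 1 - s"
  proof
    assume "s = - 1 - s"
    moreover have "2 * s + 1 = s - (- 1 - s)" by (simp add: algebra_simps)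
    ultimately show False using assms by simp
  qed
qed

text \<open>Comparing the coefficients of X^2 and X gives two linear equations for \<open>p\<close>
  and \<open>p'\<close> with determinant \<open>2 * s + 1\<close>. Hence each admissible
  \<open>s\<close> factors exactly one quartic of the family, the one with constant term
  \<open>p * p'\<close>; this is what makes factorizations countable over all
  \<open>a\<close>.\<close>

lemma quartic_factorization:
  fixes u v s x :: "'a::field"
  assumes s: "2 * s + 1 \<noteq> 0"
  defines "p \<equiv> factor_const u v s" and "p' \<equiv> factor_const u v (- 1 - s)"
  shows "x ^ 4 + x ^ 3 + u * x\<^sup>2 + v * x + p * p' = (x\<^sup>2 - s * x + p) * (x\<^sup>2 - (- 1 - s) * x + p')"
proof -
  have p: "(2 * s + 1) * p = s ^ 3 + s\<^sup>2 + u * s + v"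
    unfolding p_def by (rule factor_const_eq[OF s])
  have p': "(2 * (- 1 - s) + 1) * p' = (- 1 - s) ^ 3 + (- 1 - s)\<^sup>2 + u * (- 1 - s) + v"
    unfolding p'_def by (rule factor_const_eq[OF complementary_sum_neq(1)[OF s]])
  have "(2 * s + 1) * (p + p' + s * (- 1 - s) - u) = 0"
    using p p' by algebra
  then have sum: "p + p' + s * (- 1 - s) = u" using s by simp
  have "(2 * s + 1) * (s * p' + (- 1 - s) * p + v) = 0"
    using p p' by algebra
  then have "s * p' + (- 1 - s) * p + v = 0" using s by simp
  then have v: "v = - (s * p' + (- 1 - s) * p)"
    by (simp only: eq_neg_iff_add_eq_0 add.commute)
  show ?thesis
    unfolding sum[symmetric] v
    by (simp add: algebra_simps power4_eq_xxxx power3_eq_cube power2_eq_square)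
qed

text \<open>Obtained by eliminating \<open>p'\<close>. It is kept free of division so that it also
  covers \<open>s = - 1 / 2\<close>, a case that \<open>two_mult_plus_one_neq_0\<close> then
  excludes.\<close>

lemma factor_const_equation:
  fixes u v s p p' :: "'a::field"
  assumes "p + p' + s * (- 1 - s) = u" and "s * p' + (- 1 - s) * p = - v"
  shows "(2 * s + 1) * p = s ^ 3 + s\<^sup>2 + u * s + v"
proof -
  have v: "v = - (s * p' + (- 1 - s) * p)" using assms(2) by simp
  show ?thesis
    unfolding assms(1)[symmetric] v by (simp add: algebra_simps power3_eq_cube power2_eq_square)
qed

lemma factor_const_unique:
  fixes u v s p p' :: "'a::field"
  assumes "2 * s + 1 \<noteq> 0" and "p + p' + s * (- 1 - s) = u" and "s * p' + (- 1 - s) * p = - v"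
  shows "p = factor_const u v s"
  using factor_const_equation[OF assms(2,3)] assms(1)
  by (simp add: factor_const_def eq_divide_eq mult.commute)

text \<open>At \<open>s = - 1 / 2\<close> the cubic on the left is (8v - 4u + 1)/8. In odd
  characteristic its vanishing means that the quartic is a polynomial in (X + 1/4)^2, the case in
  which two factors can share the same linear coefficient.\<close>

lemma two_mult_plus_one_neq_0:
  fixes s u v :: "'a::field"
  assumes nondeg: "8 * v - 4 * u + 1 \<noteq> 0" and "s ^ 3 + s\<^sup>2 + u * s + v = (2 * s + 1) * c"
  shows "2 * s + 1 \<noteq> 0"
proof
  assume s: "2 * s + 1 = 0"
  have "8 * v - 4 * u + 1 = 0" using assms(2) s by algebra
  then show False using nondeg by simp
qed

lemma factor_disc_eq_disc_line:
  fixes u v s :: "'a::field"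
  assumes two: "(2::'a) \<noteq> 0" and s: "2 * s + 1 \<noteq> 0"
  shows "factor_disc u v s = - 4 / (2 * s + 1) * disc_line s (u, v)"
proof -
  have "(2 * s + 1) * factor_disc u v s = (2 * s + 1) * s\<^sup>2 - 4 * ((2 * s + 1) * factor_const u v s)"
    by (simp add: factor_disc_def algebra_simps)
  also have "\<dots> = - (2 * s ^ 3 + 3 * s\<^sup>2) - 4 * (u * s + v)"
    unfolding factor_const_eq[OF s] by (simp add: algebra_simps power2_eq_square power3_eq_cube)
  also have "\<dots> = - 4 * disc_line s (u, v)"
    using four_neq_0[OF two] by (simp add: disc_line_def distrib_left)
  finally have "factor_disc u v s = - 4 * disc_line s (u, v) / (2 * s + 1)"
    using s by (metis nonzero_mult_div_cancel_left)
  then show ?thesis by simp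
qed

text \<open>Distinct roots of one quartic yield the factor (X - x)(X - y), whose constant term is
  dictated by its linear coefficient. The same division by x - y as for the cubic gives both
  directions.\<close>

lemma collision_iff:
  fixes u v x y :: "'a::field"
  assumes nondeg: "8 * v - 4 * u + 1 \<noteq> 0" and "x \<noteq> y"
  shows "x ^ 4 + x ^ 3 + u * x\<^sup>2 + v * x = y ^ 4 + y ^ 3 + u * y\<^sup>2 + v * y \<longleftrightarrow>
    2 * (x + y) + 1 \<noteq> 0 \<and> x * y = factor_const u v (x + y)"
proof -
  let ?s = "x + y"
  have "x ^ 4 + x ^ 3 + u * x\<^sup>2 + v * x - (y ^ 4 + y ^ 3 + u * y\<^sup>2 + v * y)
    = (x - y) * (?s ^ 3 + ?s\<^sup>2 + u * ?s + v - (2 * ?s + 1) * (x * y))"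
    by algebra
  then have "x ^ 4 + x ^ 3 + u * x\<^sup>2 + v * x = y ^ 4 + y ^ 3 + u * y\<^sup>2 + v * y \<longleftrightarrow>
      ?s ^ 3 + ?s\<^sup>2 + u * ?s + v = (2 * ?s + 1) * (x * y)"
    using \<open>x \<noteq> y\<close> by (metis mult_eq_0_iff right_minus_eq)
  also have "\<dots> \<longleftrightarrow> 2 * ?s + 1 \<noteq> 0 \<and> x * y = factor_const u v ?s"
    using two_mult_plus_one_neq_0[OF nondeg] factor_const_eq by (metis mult_left_cancel)
  finally show ?thesis .
qed

section \<open>Roots and quadratic factors of a single quartic\<close>

context
  fixes u v a :: "'a::finite_field"
  assumes two: "(2::'a) \<noteq> 0" and nondeg: "8 * v - 4 * u + 1 \<noteq> 0"
begin

private definition "R = {x. x ^ 4 + x ^ 3 + u * x\<^sup>2 + v * x + a = 0}"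
text \<open>Each factorization into two quadratics is recorded twice, by \<open>s\<close> and by
  \<open>- 1 - s\<close>.\<close>

private definition "F = {s. 2 * s + 1 \<noteq> 0 \<and> factor_const u v s * factor_const u v (- 1 - s) = a}"
text \<open>The weight is 2 if both factors have distinct roots in the field or both are
  irreducible, 0 if exactly one is irreducible and the other has distinct roots, and 1 if some
  discriminant vanishes.\<close>

private definition "wt s = 1 + quad_char (factor_disc u v s * factor_disc u v (- 1 - s))"

private lemma wt_nonneg: "wt s \<ge> 0"
  using abs_quad_char_le[of "factor_disc u v s * factor_disc u v (- 1 - s)"] by (simp add: wt_def)

private lemma complement_mem_F: "s \<in> F \<Longrightarrow> - 1 - s \<in> F"
  using complementary_sum_neq(1)[of s] by (auto simp: F_def mult.commute)

private lemma neq_complement: "s \<in> F \<Longrightarrow> s \<noteq> - 1 - s"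
  using complementary_sum_neq(2)[of s] by (simp add: F_def)

private lemma wt_complement: "wt (- 1 - s) = wt s"
  by (simp add: wt_def mult.commute)

private lemma mem_R_iff:
  assumes "s \<in> F"
  shows "x \<in> R \<longleftrightarrow> x\<^sup>2 - s * x + factor_const u v s = 0 \<or>
    x\<^sup>2 - (- 1 - s) * x + factor_const u v (- 1 - s) = 0"
  using assms quartic_factorization[of s x u v] by (auto simp: R_def F_def)

text \<open>The collision criterion identifies \<open>x * y\<close> with the factor constant;
  evaluating the factorization identity at the root \<open>x\<close> then identifies the product of
  the two constants with \<open>a\<close>.\<close>

private lemma two_roots:
  assumes "x \<in> R" "y \<in> R" "x \<noteq> y"
  shows "x + y \<in> F" "factor_const u v (x + y) = x * y"
proof -
  let ?g = "\<lambda>x. x ^ 4 + x ^ 3 + u * x\<^sup>2 + v * x"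
  let ?p = "factor_const u v"
  have x: "?g x + a = 0" and y: "?g y + a = 0"
    using assms by (simp_all add: R_def)
  then have "?g x + a = ?g y + a" by (simp only:)
  then have "?g x = ?g y" by (simp only: add_right_cancel)
  then have s: "2 * (x + y) + 1 \<noteq> 0" and p: "?p (x + y) = x * y"
    using collision_iff[OF nondeg \<open>x \<noteq> y\<close>] by auto
  have "?g x + ?p (x + y) * ?p (- 1 - (x + y))
    = (x\<^sup>2 - (x + y) * x + ?p (x + y)) * (x\<^sup>2 - (- 1 - (x + y)) * x + ?p (- 1 - (x + y)))"
    by (rule quartic_factorization[OF s])
  also have "x\<^sup>2 - (x + y) * x + ?p (x + y) = 0"
    unfolding p by (simp add: algebra_simps power2_eq_square)
  finally have "?g x + ?p (x + y) * ?p (- 1 - (x + y)) = ?g x + a"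
    using x by simp
  then have "?p (x + y) * ?p (- 1 - (x + y)) = a"
    by (simp only: add_left_cancel)
  with s show "x + y \<in> F" by (simp add: F_def)
  show "?p (x + y) = x * y" by (rule p)
qed

text \<open>The factor complementary to (X - x)(X - y) has the root \<open>z\<close>, hence also
  \<open>w\<close>, because the roots sum to -1. So both factors split, and their discriminants are
  the squares of x - y and z - w.\<close>

private lemma three_roots:
  assumes "x \<in> R" "y \<in> R" "z \<in> R" "x \<noteq> y" "x \<noteq> z" "y \<noteq> z"
    and w_def: "w = - 1 - x - y - z"
  shows "R = {x, y, z, w}" "w \<noteq> z \<Longrightarrow> wt (x + y) = 2"
proof -
  let ?p' = "factor_const u v (- 1 - (x + y))"
  have factors: "t \<in> R \<longleftrightarrow> (t - x) * (t - y) = 0 \<or> t\<^sup>2 - (- 1 - (x + y)) * t + ?p' = 0" for t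
  proof -
    have "t\<^sup>2 - (x + y) * t + x * y = (t - x) * (t - y)"
      by (simp add: algebra_simps power2_eq_square)
    then show ?thesis
      using mem_R_iff[OF two_roots(1)[OF assms(1,2,4)], of t]
      unfolding two_roots(2)[OF assms(1,2,4)] by simp
  qed
  have "z\<^sup>2 - (- 1 - (x + y)) * z + ?p' = 0"
    using factors[of z] assms(3,5,6) by simp
  then have "?p' = (- 1 - (x + y)) * z - z\<^sup>2"
    by (metis add_eq_0_iff minus_diff_eq)
  then have p': "?p' = z * w"
    unfolding w_def by (simp add: algebra_simps power2_eq_square)
  have "t\<^sup>2 - (- 1 - (x + y)) * t + ?p' = (t - z) * (t - w)" for t
    unfolding p' w_def by (simp add: algebra_simps power2_eq_square)
  then show "R = {x, y, z, w}"
    using factors by auto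
  assume "w \<noteq> z"
  have "factor_disc u v (x + y) = (x - y)\<^sup>2"
    unfolding factor_disc_def two_roots(2)[OF assms(1,2,4)]
    by (simp add: algebra_simps power2_eq_square)
  moreover have "factor_disc u v (- 1 - (x + y)) = (z - w)\<^sup>2"
  proof -
    have "- 1 - (x + y) = z + w" by (simp add: w_def)
    then show ?thesis
      unfolding factor_disc_def p' by (simp add: algebra_simps power2_eq_square)
  qed
  ultimately have "factor_disc u v (x + y) * factor_disc u v (- 1 - (x + y)) = ((x - y) * (z - w))\<^sup>2"
    by (simp only: power_mult_distrib)
  then show "wt (x + y) = 2"
    using quad_char_square[of "(x - y) * (z - w)"] \<open>w \<noteq> z\<close> \<open>x \<noteq> y\<close> by (simp add: wt_def)
qed

private lemma sum_wt_ge: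
  assumes "S \<subseteq> F"
  shows "(\<Sum>s\<in>S. wt s) \<le> (\<Sum>s\<in>F. wt s)"
  using assms by (intro sum_mono2) (auto simp: wt_nonneg)

private lemma sum_wt_ge_4:
  assumes "s \<in> F" "wt s = 2"
  shows "(\<Sum>s\<in>F. wt s) \<ge> 4"
proof -
  have "(\<Sum>s\<in>{s, - 1 - s}. wt s) = 4"
    using assms neq_complement[of s] by (simp add: wt_complement)
  then show ?thesis using sum_wt_ge[of "{s, - 1 - s}"] assms complement_mem_F[of s] by simp
qed

private lemma root_of_factor:
  assumes "s \<in> F" "quad_char (factor_disc u v s) \<noteq> - 1"
  shows "R \<noteq> {}"
proof -
  obtain d where d: "d\<^sup>2 = factor_disc u v s"
    using assms(2) by (auto simp: quad_char_def split: if_splits)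
  let ?x = "(s + d) / 2"
  have "4 * (?x\<^sup>2 - s * ?x + factor_const u v s) = (2 * ?x)\<^sup>2 - 2 * s * (2 * ?x) + 4 * factor_const u v s"
    by (simp add: algebra_simps power2_eq_square)
  also have "2 * ?x = s + d" using two by simp
  also have "(s + d)\<^sup>2 - 2 * s * (s + d) + 4 * factor_const u v s = 0"
    using d unfolding factor_disc_def by algebra
  finally have "?x\<^sup>2 - s * ?x + factor_const u v s = 0"
    using four_neq_0[OF two] by (metis mult_eq_0_iff)
  then show ?thesis using mem_R_iff[OF assms(1), of ?x] by auto
qed

text \<open>
  The weights \<open>1 / 2\<close> and \<open>1 / 4\<close> make this an equality for every factorization type of a separable quartic.
\<close>
lemma quartic_indicator_ge:
  defines "k \<equiv> real (card {x. x ^ 4 + x ^ 3 + u * x\<^sup>2 + v * x + a = 0})"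
    and "Q \<equiv> {s. 2 * s + 1 \<noteq> 0 \<and> factor_const u v s * factor_const u v (- 1 - s) = a}"
  shows "1 - k + k * (k - 1) / 2
      - (\<Sum>s\<in>Q. 1 + quad_char (factor_disc u v s * factor_disc u v (- 1 - s))) / 4
    \<le> of_bool ((\<forall>x. x ^ 4 + x ^ 3 + u * x\<^sup>2 + v * x + a \<noteq> 0) \<and> Q = {})"
proof -
  have wt: "(\<Sum>s\<in>F. 1 + quad_char (factor_disc u v s * factor_disc u v (- 1 - s))) = (\<Sum>s\<in>F. wt s)"
    by (simp add: wt_def)
  have nonneg: "(\<Sum>s\<in>F. wt s) \<ge> 0" by (intro sum_nonneg wt_nonneg)
  have k: "k = real (card R)" by (simp add: k_def R_def)
  have no_root: "(\<forall>x. x ^ 4 + x ^ 3 + u * x\<^sup>2 + v * x + a \<noteq> 0) \<longleftrightarrow> R = {}" by (auto simp: R_def)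
  have Q: "Q = F" by (simp add: Q_def F_def)
  \<comment> \<open>For k = 0, 1, 2, 3, 4 the expression 1 - k + k(k - 1)/2 is 1, 0, 0, 1, 3. So
    nonnegativity of the weights suffices for k = 1 and k = 2, while total weight 4 is required for
    k = 3 and for k = 0 with a factorization, and 12 for k = 4.\<close>
  consider "card R = 0" | "card R = 1" | "card R = 2" | "card R \<ge> 3" by linarith
  then have "1 - k + k * (k - 1) / 2 - (\<Sum>s\<in>F. wt s) / 4 \<le> of_bool (R = {} \<and> F = {})"
  proof cases
    case 1
    then have R: "R = {}" by simp
    have "(\<Sum>s\<in>F. wt s) \<ge> 4" if "F \<noteq> {}"
    proof -
      from \<open>F \<noteq> {}\<close> obtain s where s: "s \<in> F" by blast
      have "quad_char (factor_disc u v s) = - 1" "quad_char (factor_disc u v (- 1 - s)) = - 1"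
        using root_of_factor[of s] root_of_factor[of "- 1 - s"] s complement_mem_F[OF s] R by auto
      then have "wt s = 2" by (simp add: wt_def quad_char_mult[OF two])
      then show ?thesis using sum_wt_ge_4 s by blast
    qed
    then show ?thesis using 1 R k by auto
  next
    case 4
    then obtain A where "A \<subseteq> R" "card A = 3"
      by (metis obtain_subset_with_card_n)
    then obtain x y z where R: "x \<in> R" "y \<in> R" "z \<in> R" and xyz: "x \<noteq> y" "x \<noteq> z" "y \<noteq> z"
      by (auto simp: card_3_iff)
    define w where "w = - 1 - x - y - z"
    have w_def': "w = - 1 - x - z - y" "w = - 1 - y - z - x"
      by (simp_all add: w_def algebra_simps)
    have eq: "R = {x, y, z, w}" by (rule three_roots(1)[OF R xyz w_def])
    show ?thesis
    proof (cases "w \<in> {x, y, z}")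
      case True
      then have "R = {x, y, z}" using eq by auto
      then have "k = 3" using xyz k by simp
      \<comment> \<open>Here \<open>w\<close> repeats one of the roots. The pairing of the roots is
        chosen so that the two copies lie in different factors; otherwise a discriminant would
        vanish and the weight would drop to 1.\<close>
      moreover have "(\<Sum>s\<in>F. wt s) \<ge> 4"
      proof (cases "w = z")
        case False
        then have "wt (x + y) = 2" using three_roots(2)[OF R xyz w_def] by simp
        then show ?thesis using sum_wt_ge_4 two_roots(1)[OF R(1,2) xyz(1)] by blast
      next
        case True
        then have "wt (x + z) = 2"
          using three_roots(2)[OF R(1,3,2) xyz(2,1) xyz(3)[symmetric] w_def'(1)] xyz by simp
        then show ?thesis using sum_wt_ge_4 two_roots(1)[OF R(1,3) xyz(2)] by blast
      qed
      ultimately show ?thesis by auto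
    next
      case False
      then have w: "w \<noteq> x" "w \<noteq> y" "w \<noteq> z" by auto
      then have k4: "k = 4" using eq xyz k by (simp add: card_insert_if)
      have wR: "w \<in> R" using eq by simp
      have mem: "x + y \<in> F" "x + z \<in> F" "y + z \<in> F" "x + w \<in> F" "y + w \<in> F" "z + w \<in> F"
        using two_roots(1) R wR xyz w by auto
      have compl: "- 1 - (x + y) = z + w" "- 1 - (x + z) = y + w" "- 1 - (y + z) = x + w"
        by (simp_all add: w_def algebra_simps)
      have neq: "x + y \<noteq> z + w" "x + z \<noteq> y + w" "y + z \<noteq> x + w"
        using neq_complement[OF mem(1)] neq_complement[OF mem(2)] neq_complement[OF mem(3)]
        unfolding compl by simp_all
      have wt1: "wt (x + y) = 2" "wt (x + z) = 2" "wt (y + z) = 2"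
        using three_roots(2)[OF R xyz w_def] w
          three_roots(2)[OF R(1,3,2) xyz(2,1) xyz(3)[symmetric] w_def'(1)]
          three_roots(2)[OF R(2,3,1) xyz(3) xyz(1,2)[symmetric] w_def'(2)]
        by simp_all
      then have wt2: "wt (z + w) = 2" "wt (y + w) = 2" "wt (x + w) = 2"
        using wt1 wt_complement[of "x + y"] wt_complement[of "x + z"] wt_complement[of "y + z"]
        unfolding compl by simp_all
      \<comment> \<open>Four roots have three pairings, each seen through two complementary sums of
        weight 2.\<close>
      let ?L = "[x + y, x + z, y + z, x + w, y + w, z + w]"
      have "distinct ?L"
        using neq xyz w by (auto simp: add.commute)
      then have "(\<Sum>s\<in>set ?L. wt s) = sum_list (map wt ?L)"
        by (rule sum.distinct_set_conv_list)
      also have "\<dots> = 12" using wt1 wt2 by simp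
      finally have "(\<Sum>s\<in>F. wt s) \<ge> 12"
        using sum_wt_ge[of "set ?L"] mem by simp
      then show ?thesis using k4 by auto
    qed
  qed (use k nonneg in auto)
  then show ?thesis unfolding wt no_root Q .
qed

end

section \<open>Counting normalized triples\<close>

text \<open>The irregular part of the count of good \<open>a\<close>. The sign
  \<open>quad_char (- 1)\<close> arises because \<open>2 * s + 1\<close> changes sign under
  \<open>s\<close> to \<open>- 1 - s\<close>, so the factors relating the two discriminants to their
  lines multiply to minus a square.\<close>

definition moment_error :: "'a::finite_field \<times> 'a \<Rightarrow> real" where
  "moment_error p =
     2 * (\<Sum>s | 2 * s + 1 \<noteq> 0. quad_char (- 4 / (2 * s + 1)) * quad_char (disc_line s p))
     - quad_char (- 1 :: 'a) * (\<Sum>s | 2 * s + 1 \<noteq> 0. quad_char (disc_line s p * disc_line (- 1 - s) p))"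

lemma sum_moment_error_square_le:
  assumes two: "(2::'a::finite_field) \<noteq> 0"
  shows "(\<Sum>p\<in>UNIV. (moment_error (p :: 'a \<times> 'a))\<^sup>2) \<le> 18 * real CARD('a) ^ 3"
proof -
  let ?A = "\<lambda>p::'a \<times> 'a. \<Sum>s | 2 * s + 1 \<noteq> 0. quad_char (- 4 / (2 * s + 1)) * quad_char (disc_line s p)"
  let ?B = "\<lambda>p::'a \<times> 'a. \<Sum>s | 2 * s + 1 \<noteq> 0. quad_char (disc_line s p * disc_line (- 1 - s) p)"
  have bound: "(moment_error p)\<^sup>2 \<le> 8 * (?A p)\<^sup>2 + 2 * (?B p)\<^sup>2" for p
  proof -
    have "(quad_char (- 1 :: 'a))\<^sup>2 = 1" by (simp add: quad_char_power2)
    then have B: "(quad_char (- 1 :: 'a) * ?B p)\<^sup>2 = (?B p)\<^sup>2" by (simp add: power_mult_distrib)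
    \<comment> \<open>The two sides differ by (2x + y)^2. With the moments 1 and 5 this gives 8 * 1
      + 2 * 5 = 18.\<close>
    have "(2 * x - y)\<^sup>2 \<le> 8 * x\<^sup>2 + 2 * y\<^sup>2" for x y :: real
      using zero_le_power2[of "2 * x + y"] by (simp add: algebra_simps power2_eq_square)
    from this[of "?A p" "quad_char (- 1 :: 'a) * ?B p"] show ?thesis
      unfolding B moment_error_def .
  qed
  have "(\<Sum>p\<in>UNIV. (moment_error (p :: 'a \<times> 'a))\<^sup>2) \<le> (\<Sum>p\<in>UNIV. 8 * (?A p)\<^sup>2 + 2 * (?B p)\<^sup>2)"
    by (intro sum_mono bound)
  also have "\<dots> = 8 * (\<Sum>p\<in>UNIV. (?A p)\<^sup>2) + 2 * (\<Sum>p\<in>UNIV. (?B p)\<^sup>2)"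
    by (simp add: sum.distrib flip: sum_distrib_left)
  also have "\<dots> \<le> 8 * real CARD('a) ^ 3 + 2 * (5 * real CARD('a) ^ 3)"
  proof (intro add_mono mult_left_mono)
    show "(\<Sum>p\<in>UNIV. (?A p)\<^sup>2) \<le> real CARD('a) ^ 3"
      by (rule second_moment_disc_lines[OF two abs_quad_char_le])
    show "(\<Sum>p\<in>UNIV. (?B p)\<^sup>2) \<le> 5 * real CARD('a) ^ 3"
      by (rule second_moment_disc_line_pairs[OF two]) (simp add: complementary_sum_neq(2))
  qed auto
  finally show ?thesis by simp
qed

definition unfactorable_quartic :: "'a::field \<Rightarrow> 'a \<Rightarrow> 'a \<Rightarrow> bool" where
  "unfactorable_quartic u v a \<longleftrightarrow> (\<forall>x. x ^ 4 + x ^ 3 + u * x\<^sup>2 + v * x + a \<noteq> 0) \<and>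
     (\<forall>s. 2 * s + 1 \<noteq> 0 \<longrightarrow> factor_const u v s * factor_const u v (- 1 - s) \<noteq> a)"

text \<open>Summing \<open>quartic_indicator_ge\<close> over \<open>a\<close>, the terms 1 and - k
  cancel. With A and B the sums of \<open>quad_char\<close> over the discriminants and over their
  products, pairs of roots give at least (q - 4 + A)/2, since one \<open>s\<close> is excluded and
  at most three discriminants vanish. Each \<open>s\<close> occurs for exactly one \<open>a\<close>,
  so the factorizations subtract (q - 1 + B)/4. Four times the difference is q - 7 + 2A - B.\<close>

lemma card_unfactorable_quartics_ge:
  fixes u v :: "'a::finite_field"
  assumes two: "(2::'a) \<noteq> 0" and nondeg: "8 * v - 4 * u + 1 \<noteq> 0"
  shows "4 * real (card {a. unfactorable_quartic u v a}) \<ge> real CARD('a) - 7 + moment_error (u, v)"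
proof -
  let ?q = "real CARD('a)"
  let ?T = "{s::'a. 2 * s + 1 \<noteq> 0}"
  let ?g = "\<lambda>x. x ^ 4 + x ^ 3 + u * x\<^sup>2 + v * x"
  let ?f = "\<lambda>x. - ?g x"
  let ?k = "\<lambda>a. real (card {x. ?f x = a})"
  let ?p = "factor_const u v" and ?D = "factor_disc u v"
  let ?w = "\<lambda>s. 1 + quad_char (?D s * ?D (- 1 - s))"
  have root: "?f x = a \<longleftrightarrow> ?g x + a = 0" for x a
    by (metis add.commute add_eq_0_iff)
  have T: "?T = UNIV - {- 1 / 2}"
  proof -
    have "2 * s + 1 = 0 \<longleftrightarrow> s = - 1 / 2" for s :: 'a
      using nonzero_eq_divide_eq[OF two, of s "- 1"] eq_neg_iff_add_eq_0[of "2 * s" 1]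
      by (simp only: mult.commute)
    then show ?thesis by auto
  qed
  have card_T: "real (card ?T) = ?q - 1"
    unfolding T by (simp add: card_Diff_singleton of_nat_diff)
  have zeros: "{s \<in> ?T. ?D s = 0} \<subseteq> {s. disc_line s (u, v) = 0}"
    using four_neq_0[OF two] by (auto simp: factor_disc_eq_disc_line[OF two])
  then have "card {s \<in> ?T. ?D s = 0} \<le> 3"
    using card_disc_line_zeros_le[OF two, of "(u, v)"] card_mono[OF finite zeros] by linarith
  then have nonzero: "(\<Sum>s\<in>?T. of_bool (?D s \<noteq> 0)) \<ge> ?q - 4"
    using card_T by (simp only: of_bool_not_iff sum_subtractf) (simp add: Int_def)
  have pair: "x \<noteq> y \<and> ?f x = ?f y \<longleftrightarrow> x \<noteq> y \<and> x + y \<in> ?T \<and> x * y = ?p (x + y)" for x y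
  proof (cases "x = y")
    case False
    have "?f x = ?f y \<longleftrightarrow> ?g x = ?g y" by (rule neg_equal_iff_equal)
    also have "\<dots> \<longleftrightarrow> 2 * (x + y) + 1 \<noteq> 0 \<and> x * y = ?p (x + y)"
      by (rule collision_iff[OF nondeg False])
    finally show ?thesis by blast
  qed simp
  have "(\<Sum>a\<in>UNIV. ?k a * (?k a - 1)) = real (card {(x, y). x \<noteq> y \<and> ?f x = ?f y})"
    by (rule sum_collisions)
  also have "\<dots> = (\<Sum>s\<in>?T. of_bool (?D s \<noteq> 0) + quad_char (?D s))"
    unfolding pair card_pairs_with_product[OF two, where p = ?p and T = ?T]
    by (simp only: factor_disc_def)
  finally have pairs: "(\<Sum>a\<in>UNIV. ?k a * (?k a - 1)) \<ge> ?q - 4 + (\<Sum>s\<in>?T. quad_char (?D s))"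
    using nonzero by (simp add: sum.distrib)
  have roots: "(\<Sum>a\<in>UNIV. ?k a) = ?q"
    by (simp only: sum_card_fibres flip: of_nat_sum)
  have "(\<Sum>a\<in>UNIV. \<Sum>s | s \<in> ?T \<and> ?p s * ?p (- 1 - s) = a. ?w s) = (\<Sum>s\<in>?T. ?w s)"
    by (rule sum.group) auto
  also have "\<dots> = ?q - 1 + (\<Sum>s\<in>?T. quad_char (?D s * ?D (- 1 - s)))"
    using card_T by (simp add: sum.distrib)
  finally have splits: "(\<Sum>a\<in>UNIV. \<Sum>s | s \<in> ?T \<and> ?p s * ?p (- 1 - s) = a. ?w s)
    = ?q - 1 + (\<Sum>s\<in>?T. quad_char (?D s * ?D (- 1 - s)))" .
  have "(\<Sum>a\<in>UNIV. 1 - ?k a + ?k a * (?k a - 1) / 2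
        - (\<Sum>s | s \<in> ?T \<and> ?p s * ?p (- 1 - s) = a. ?w s) / 4)
      \<le> (\<Sum>a\<in>UNIV. of_bool (unfactorable_quartic u v a))"
  proof (rule sum_mono)
    fix a
    have "unfactorable_quartic u v a \<longleftrightarrow> (\<forall>x. ?g x + a \<noteq> 0) \<and>
        {s. 2 * s + 1 \<noteq> 0 \<and> ?p s * ?p (- 1 - s) = a} = {}"
      by (auto simp: unfactorable_quartic_def)
    then show "1 - ?k a + ?k a * (?k a - 1) / 2
        - (\<Sum>s | s \<in> ?T \<and> ?p s * ?p (- 1 - s) = a. ?w s) / 4
      \<le> of_bool (unfactorable_quartic u v a)"
      using quartic_indicator_ge[OF two nondeg, of a] unfolding root by (simp only: mem_Collect_eq)
  qed
  also have "\<dots> = real (card {a. unfactorable_quartic u v a})"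
    by simp
  finally have "(\<Sum>a\<in>UNIV. 1 - ?k a + ?k a * (?k a - 1) / 2
        - (\<Sum>s | s \<in> ?T \<and> ?p s * ?p (- 1 - s) = a. ?w s) / 4)
      \<le> real (card {a. unfactorable_quartic u v a})" .
  moreover have "(\<Sum>a\<in>UNIV. 1 - ?k a + ?k a * (?k a - 1) / 2
        - (\<Sum>s | s \<in> ?T \<and> ?p s * ?p (- 1 - s) = a. ?w s) / 4)
      = ?q - (\<Sum>a\<in>UNIV. ?k a) + (\<Sum>a\<in>UNIV. ?k a * (?k a - 1)) / 2
        - (\<Sum>a\<in>UNIV. \<Sum>s | s \<in> ?T \<and> ?p s * ?p (- 1 - s) = a. ?w s) / 4"
  proof -
    have "(\<Sum>a\<in>(UNIV::'a set). 1 - f a + g a / 2 - h a / 4) = ?q - sum f UNIV + sum g UNIV / 2 - sum h UNIV / 4"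
      for f g h :: "'a \<Rightarrow> real"
      by (simp add: sum.distrib sum_subtractf sum_divide_distrib)
    then show ?thesis .
  qed
  ultimately have "4 * real (card {a. unfactorable_quartic u v a}) \<ge> ?q - 7
      + (2 * (\<Sum>s\<in>?T. quad_char (?D s)) - (\<Sum>s\<in>?T. quad_char (?D s * ?D (- 1 - s))))"
    using pairs roots splits by argo
  moreover have "(\<Sum>s\<in>?T. quad_char (?D s))
      = (\<Sum>s\<in>?T. quad_char (- 4 / (2 * s + 1)) * quad_char (disc_line s (u, v)))"
    by (rule sum.cong[OF refl])
      (simp only: mem_Collect_eq factor_disc_eq_disc_line[OF two] quad_char_mult[OF two] not_False_eq_True)
  moreover have "(\<Sum>s\<in>?T. quad_char (?D s * ?D (- 1 - s)))
      = quad_char (- 1 :: 'a) * (\<Sum>s\<in>?T. quad_char (disc_line s (u, v) * disc_line (- 1 - s) (u, v)))"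
    unfolding sum_distrib_left
  proof (rule sum.cong[OF refl])
    fix s :: 'a assume "s \<in> ?T"
    then have s: "2 * s + 1 \<noteq> 0" by simp
    have neg: "2 * (- 1 - s) + 1 = - (2 * s + 1)" by (simp add: algebra_simps)
    have "?D (- 1 - s) = 4 / (2 * s + 1) * disc_line (- 1 - s) (u, v)"
      using factor_disc_eq_disc_line[OF two complementary_sum_neq(1)[OF s], of u v]
      unfolding neg minus_divide_divide .
    moreover have "?D s = - (4 / (2 * s + 1)) * disc_line s (u, v)"
      using factor_disc_eq_disc_line[OF two s, of u v] by simp
    ultimately have "?D s * ?D (- 1 - s) = (4 / (2 * s + 1))\<^sup>2 * (- 1 *
        (disc_line s (u, v) * disc_line (- 1 - s) (u, v)))"
      by (simp add: power2_eq_square)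
    moreover have "4 / (2 * s + 1) \<noteq> 0" using s four_neq_0[OF two] by simp
    ultimately show "quad_char (?D s * ?D (- 1 - s))
      = quad_char (- 1 :: 'a) * quad_char (disc_line s (u, v) * disc_line (- 1 - s) (u, v))"
      by (simp only: quad_char_mult_square not_False_eq_True quad_char_mult[OF two, of "- 1"])
  qed
  ultimately show ?thesis by (simp add: moment_error_def)
qed

section \<open>Counting the pairs (u, v)\<close>

lemma card_nonsquares:
  assumes two: "(2::'a::finite_field) \<noteq> 0"
  shows "2 * real (card {x::'a. quad_char x = - 1}) = real CARD('a) - 1"
proof -
  have "2 * of_bool (quad_char x = - 1) = 1 - quad_char x - of_bool (x = 0)" for x :: 'a
    by (cases x rule: quad_char_cases) auto
  then have "(\<Sum>x\<in>(UNIV::'a set). 2 * of_bool (quad_char x = - 1))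
    = (\<Sum>x\<in>(UNIV::'a set). 1 - quad_char x - of_bool (x = 0))" by simp
  then show ?thesis
    using sum_quad_char[OF two] by (simp add: sum_subtractf flip: sum_distrib_left)
qed

text \<open>
  The first and third conditions make \<open>X\<^sup>2 + X + u\<close> and \<open>X\<^sup>3 + X\<^sup>2 + u X + v\<close> irreducible. For \<open>3 u = 1\<close> the
  conic behind \<open>card_rootless_cubics_ge\<close> is degenerate.
\<close>
definition base_pairs :: "('a::finite_field \<times> 'a) set" where
  "base_pairs = {(u, v). quad_char (1 - 4 * u) = - 1 \<and> 3 * u \<noteq> 1 \<and>
     (\<forall>x. x ^ 3 + x\<^sup>2 + u * x + v \<noteq> 0) \<and> 8 * v - 4 * u + 1 \<noteq> 0}"

text \<open>Each exceptional condition costs one element: (q - 1)/2 nonsquare discriminants less the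
  \<open>u\<close> with \<open>3 * u = 1\<close>, then for each \<open>u\<close> the (q - 3)/3
  rootless cubics less one degenerate \<open>v\<close>.\<close>

lemma card_base_pairs_ge:
  assumes two: "(2::'a::finite_field) \<noteq> 0" and three: "(3::'a) \<noteq> 0" and q: "CARD('a) \<ge> 6"
  shows "real (card (base_pairs :: ('a \<times> 'a) set)) \<ge> (real CARD('a) - 3) * (real CARD('a) - 6) / 6"
proof -
  let ?q = "real CARD('a)"
  define U where "U = {u::'a. quad_char (1 - 4 * u) = - 1 \<and> 3 * u \<noteq> 1}"
  define V where "V = (\<lambda>u::'a. {v. (\<forall>x. x ^ 3 + x\<^sup>2 + u * x + v \<noteq> 0) \<and> 8 * v - 4 * u + 1 \<noteq> 0})"
  have eight: "(8::'a) \<noteq> 0"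
  proof -
    have "(8::'a) = 2 * 4" by simp
    then show ?thesis using two four_neq_0[OF two] by (metis mult_eq_0_iff)
  qed
  have "bij (\<lambda>u::'a. (- 4) * u + 1)" using four_neq_0[OF two] by (intro bij_affine) simp
  then have "bij_betw (\<lambda>u::'a. (- 4) * u + 1) {u. quad_char (1 - 4 * u) = - 1} {x. quad_char x = - 1}"
    by (auto simp: bij_betw_def inj_on_def image_iff)
  then have "card {u::'a. quad_char (1 - 4 * u) = - 1} = card {x::'a. quad_char x = - 1}"
    by (rule bij_betw_same_card)
  moreover have "card {u::'a. quad_char (1 - 4 * u) = - 1} \<le> Suc (card U)"
  proof -
    have "{u::'a. quad_char (1 - 4 * u) = - 1} \<subseteq> insert (1 / 3) U"
      using three by (auto simp: U_def eq_divide_eq mult.commute)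
    then have "card {u::'a. quad_char (1 - 4 * u) = - 1} \<le> card (insert (1 / 3) U)"
      by (rule card_mono[rotated]) simp
    also have "\<dots> \<le> Suc (card U)" by (rule card_insert_le_m1[of "Suc (card U)", simplified]) simp
    finally show ?thesis .
  qed
  ultimately have U: "real (card U) \<ge> (?q - 3) / 2"
    using card_nonsquares[OF two] by simp
  have V: "real (card (V u)) \<ge> (?q - 6) / 3" if "u \<in> U" for u
  proof -
    let ?W = "{v. \<forall>x. x ^ 3 + x\<^sup>2 + u * x + v \<noteq> 0}"
    have exceptional: "v = (4 * u - 1) / 8" if "8 * v - 4 * u + 1 = 0" for v
    proof -
      have "8 * v = (8 * v - 4 * u + 1) + (4 * u - 1)" by simp
      then have "8 * v = 4 * u - 1" using that by simp
      then show ?thesis using eight by (metis nonzero_mult_div_cancel_left)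
    qed
    have "?W \<subseteq> insert ((4 * u - 1) / 8) (V u)"
      using exceptional unfolding V_def by blast
    then have "card ?W \<le> card (insert ((4 * u - 1) / 8) (V u))"
      by (rule card_mono[rotated]) simp
    also have "\<dots> \<le> Suc (card (V u))" by (rule card_insert_le_m1[of "Suc (card (V u))", simplified]) simp
    finally show ?thesis
      using card_rootless_cubics_ge[OF two three, of u] that by (simp add: U_def)
  qed
  have base: "base_pairs = Sigma U V"
    by (auto simp: base_pairs_def U_def V_def)
  have "card (base_pairs :: ('a \<times> 'a) set) = (\<Sum>u\<in>U. card (V u))"
    unfolding base by (rule card_SigmaI) auto
  then have "real (card (base_pairs :: ('a \<times> 'a) set)) = (\<Sum>u\<in>U. real (card (V u)))"
    by (simp only: of_nat_sum)
  also have "\<dots> \<ge> (\<Sum>u\<in>U. (?q - 6) / 3)"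
    by (rule sum_mono) (rule V)
  finally have "real (card (base_pairs :: ('a \<times> 'a) set)) \<ge> real (card U) * ((?q - 6) / 3)"
    by simp
  moreover have "real (card U) * ((?q - 6) / 3) \<ge> (?q - 3) / 2 * ((?q - 6) / 3)"
    using U q by (intro mult_right_mono) auto
  ultimately show ?thesis by simp
qed

definition normalized_triples :: "('a::finite_field \<times> 'a \<times> 'a) set" where
  "normalized_triples = {(u, v, a). (u, v) \<in> base_pairs \<and> unfactorable_quartic u v a}"

lemma card_normalized_triples_ge:
  assumes two: "(2::'a::finite_field) \<noteq> 0" and three: "(3::'a) \<noteq> 0" and q_ge: "CARD('a) \<ge> 504"
  defines "q \<equiv> real CARD('a)"
  shows "24 * real (card (normalized_triples :: ('a \<times> 'a \<times> 'a) set)) \<ge>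
    (q - 22 * sqrt q - 10) * (q\<^sup>2 - 2 * q * sqrt q - 18 * q + 18 * sqrt q + 57)"
proof -
  define r where "r = sqrt q"
  let ?S = "base_pairs :: ('a \<times> 'a) set"
  let ?n = "real (card ?S)"
  have q504: "q \<ge> 504" using q_ge by (simp add: q_def)
  have r: "r\<^sup>2 = q" using q504 by (simp add: r_def)
  have r22: "r \<ge> 22"
    unfolding r_def by (rule real_le_rsqrt) (use q504 in simp)
  have "bij_betw (\<lambda>((u, v), a). (u, v, a)) (Sigma ?S (\<lambda>(u, v). {a. unfactorable_quartic u v a}))
      (normalized_triples :: ('a \<times> 'a \<times> 'a) set)"
    by (rule bij_betw_byWitness[where f' = "\<lambda>(u, v, a). ((u, v), a)"])
      (auto simp: normalized_triples_def)
  then have "real (card (normalized_triples :: ('a \<times> 'a \<times> 'a) set))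
    = real (card (Sigma ?S (\<lambda>(u, v). {a. unfactorable_quartic u v a})))"
    by (simp only: bij_betw_same_card)
  also have "\<dots> = (\<Sum>(u, v)\<in>?S. real (card {a. unfactorable_quartic u v a}))"
    by (subst card_SigmaI) (auto simp: case_prod_beta)
  finally have "4 * real (card (normalized_triples :: ('a \<times> 'a \<times> 'a) set))
    = (\<Sum>(u, v)\<in>?S. 4 * real (card {a. unfactorable_quartic u v a}))"
    by (simp add: sum_distrib_left case_prod_beta)
  also have "\<dots> \<ge> (\<Sum>p\<in>?S. q - 7 - 3 * r - (moment_error p)\<^sup>2 / (12 * r))"
  proof (rule sum_mono, clarify)
    fix u v :: 'a assume "(u, v) \<in> ?S"
    then have "4 * real (card {a. unfactorable_quartic u v a}) \<ge> q - 7 + moment_error (u, v)"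
      unfolding q_def by (intro card_unfactorable_quartics_ge[OF two]) (simp add: base_pairs_def)
    \<comment> \<open>A first power is traded for a square, which can be summed over the plane. The
      shift 6r is of the order of the root mean square of \<open>moment_error\<close>, at most sqrt
      18 * r; it yields the losses 3 q^2 r and 9 q^2 r in the final estimate.\<close>
    moreover have weighted: "e \<ge> - 3 * r - e\<^sup>2 / (12 * r)" for e
    proof -
      have "(e + 6 * r)\<^sup>2 / (12 * r) \<ge> 0" using r22 by simp
      also have "(e + 6 * r)\<^sup>2 / (12 * r) = e\<^sup>2 / (12 * r) + e + 3 * r"
        using r22 by (simp add: power2_eq_square field_simps)
      finally show ?thesis by simp
    qed
    ultimately show "q - 7 - 3 * r - (moment_error (u, v))\<^sup>2 / (12 * r)
        \<le> 4 * real (card {a. unfactorable_quartic u v a})"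
      using weighted[of "moment_error (u, v)"] by linarith
  qed
  also have "(\<Sum>p\<in>?S. c - f p / d) = ?n * c - (\<Sum>p\<in>?S. f p) / d" for c d f
    by (simp add: sum_subtractf sum_divide_distrib)
  finally have "4 * real (card (normalized_triples :: ('a \<times> 'a \<times> 'a) set)) \<ge>
      ?n * (q - 7 - 3 * r) - (\<Sum>p\<in>?S. (moment_error p)\<^sup>2) / (12 * r)" .
  moreover have "(\<Sum>p\<in>?S. (moment_error p)\<^sup>2) / (12 * r) \<le> 3 / 2 * q\<^sup>2 * r"
  proof -
    have "(\<Sum>p\<in>?S. (moment_error p)\<^sup>2) \<le> (\<Sum>p\<in>UNIV. (moment_error (p :: 'a \<times> 'a))\<^sup>2)"
      by (rule sum_mono2) auto
    also have "\<dots> \<le> 18 * q ^ 3"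
      unfolding q_def by (rule sum_moment_error_square_le[OF two])
    finally have "(\<Sum>p\<in>?S. (moment_error p)\<^sup>2) / (12 * r) \<le> 18 * q ^ 3 / (12 * r)"
      using r22 by (intro divide_right_mono) auto
    also have "\<dots> = 3 / 2 * q\<^sup>2 * r"
      using r22 unfolding r[symmetric] by (simp add: field_simps power2_eq_square power3_eq_cube)
    finally show ?thesis .
  qed
  moreover have "?n * (q - 7 - 3 * r) \<ge> (q - 3) * (q - 6) / 6 * (q - 7 - 3 * r)"
  proof (rule mult_right_mono)
    show "(q - 3) * (q - 6) / 6 \<le> ?n"
      unfolding q_def using q_ge by (intro card_base_pairs_ge[OF two three]) simp
    \<comment> \<open>The count of base pairs is only bounded from below, so its cofactor must be
      nonnegative.\<close>
    have "r * r \<ge> 22 * r" using r22 by (intro mult_right_mono) auto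
    then show "q - 7 - 3 * r \<ge> 0"
      using r22 unfolding r[symmetric] power2_eq_square by linarith
  qed
  ultimately have "24 * real (card (normalized_triples :: ('a \<times> 'a \<times> 'a) set)) \<ge>
      (q - 3) * (q - 6) * (q - 7 - 3 * r) - 9 * q\<^sup>2 * r"
    by (simp add: field_simps)
  \<comment> \<open>As a polynomial in \<open>r\<close> the difference has leading term 12 r^5, the
    gap between the losses 24 q^2 r and 12 q^2 r; from r \<ge> 22 on it dominates the negative
    terms.\<close>
  moreover have "(q - 3) * (q - 6) * (q - 7 - 3 * r) - 9 * q\<^sup>2 * r
      - (q - 22 * r - 10) * (q\<^sup>2 - 2 * q * r - 18 * q + 18 * r + 57)
    = r ^ 3 * (r * (12 * r - 32) - 407) + 240 * r\<^sup>2 + 1380 * r + 444"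
    unfolding r[symmetric] by (simp add: algebra_simps eval_nat_numeral)
  moreover have "r ^ 3 * (r * (12 * r - 32) - 407) + 240 * r\<^sup>2 + 1380 * r + 444 \<ge> 0"
  proof -
    have "22 * 232 \<le> r * (12 * r - 32)"
      using r22 by (intro mult_mono) auto
    then have "r ^ 3 * (r * (12 * r - 32) - 407) \<ge> 0"
      using r22 by (intro mult_nonneg_nonneg) auto
    then show ?thesis using r22 by simp
  qed
  ultimately show ?thesis by (simp add: r_def)
qed

section \<open>From triples to polynomial sequences\<close>

lemma degree_1_imp_root:
  fixes p :: "'a::field poly"
  assumes "degree p = 1"
  shows "\<exists>x. poly p x = 0"
proof -
  obtain c d where p: "p = [:c, d:]"
    using assms by (metis degree_eq_zeroE degree_pCons_eq_if nat.distinct(1) nat.inject One_nat_def pCons_cases)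
  then have "d \<noteq> 0" using assms by auto
  then have "poly p (- c / d) = 0" by (simp add: p)
  then show ?thesis ..
qed

lemma irreducible_polyI:
  fixes p :: "'a::field poly"
  assumes "degree p > 0"
    and "\<And>a b. p = a * b \<Longrightarrow> degree a > 0 \<Longrightarrow> degree b > 0 \<Longrightarrow> False"
  shows "irreducible p"
proof (rule irreducibleI)
  show "p \<noteq> 0" using assms(1) by auto
  then show "\<not> p dvd 1" using assms(1) by (simp add: is_unit_iff_degree)
  fix a b assume ab: "p = a * b"
  then have "a \<noteq> 0" "b \<noteq> 0" using \<open>p \<noteq> 0\<close> by auto
  then show "a dvd 1 \<or> b dvd 1"
    using assms(2)[OF ab] by (auto simp: is_unit_iff_degree)
qed

lemma irreducible_degree_le_3I:
  fixes p :: "'a::field poly"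
  assumes "degree p > 0" "degree p \<le> 3" and no_root: "\<And>x. poly p x \<noteq> 0"
  shows "irreducible p"
proof (rule irreducible_polyI)
  fix a b assume p: "p = a * b" and "degree a > 0" "degree b > 0"
  moreover have "degree p = degree a + degree b"
    unfolding p using assms(1) p by (intro degree_mult_eq) auto
  ultimately have "degree a = 1 \<or> degree b = 1"
    using assms(2) by linarith
  then obtain x where "poly a x = 0 \<or> poly b x = 0"
    using degree_1_imp_root by blast
  then show False using no_root[of x] p by auto
qed (rule assms)

lemma degree_2_cases:
  fixes p :: "'a::field poly"
  assumes "degree p = 2"
  obtains c0 c1 c2 where "p = [:c0, c1, c2:]" "c2 \<noteq> 0"
proof -
  have "p = [:coeff p 0, coeff p 1, coeff p 2:]"
  proof (rule poly_eqI)
    fix n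
    show "coeff p n = coeff [:coeff p 0, coeff p 1, coeff p 2:] n"
    proof (cases "n \<le> 2")
      case True
      then consider "n = 0" | "n = 1" | "n = 2" by linarith
      then show ?thesis by cases (auto simp: numeral_2_eq_2)
    next
      case False
      then have "coeff p n = 0" using assms by (intro coeff_eq_0) simp
      moreover have "coeff [:coeff p 0, coeff p 1, coeff p 2:] n = 0"
        using False by (intro coeff_eq_0) (auto intro: le_less_trans[OF degree_pCons_le])
      ultimately show ?thesis by simp
    qed
  qed
  moreover have "coeff p 2 \<noteq> 0" using assms by (metis leading_coeff_0_iff degree_0 zero_neq_numeral)
  ultimately show thesis using that by blast
qed

lemma irreducible_quarticI:
  fixes u v a :: "'a::field"
  assumes nondeg: "8 * v - 4 * u + 1 \<noteq> 0" and unfactorable: "unfactorable_quartic u v a"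
  shows "irreducible [:a, v, u, 1, 1:]"
proof (rule irreducible_polyI)
  let ?p = "[:a, v, u, 1, 1:]"
  have no_root: "poly ?p x \<noteq> 0" for x
  proof -
    have eq: "poly ?p x = x ^ 4 + x ^ 3 + u * x\<^sup>2 + v * x + a"
      by (simp add: algebra_simps eval_nat_numeral)
    show ?thesis
      unfolding eq using unfactorable unfolding unfactorable_quartic_def by blast
  qed
  fix f g assume p: "?p = f * g" and pos: "degree f > 0" "degree g > 0"
  have "degree ?p = degree f + degree g"
    unfolding p using pos by (intro degree_mult_eq) auto
  then have "degree f + degree g = 4" by simp
  moreover have "degree f \<noteq> 1" "degree g \<noteq> 1"
    using degree_1_imp_root[of f] degree_1_imp_root[of g] no_root unfolding p by auto
  ultimately have "degree f = 2" "degree g = 2" using pos by linarith+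
  then obtain a0 a1 a2 b0 b1 b2 where fg: "f = [:a0, a1, a2:]" "g = [:b0, b1, b2:]"
    by (metis degree_2_cases)
  have coeffs: "a = a0 * b0" "v = a0 * b1 + a1 * b0" "u = a0 * b2 + a1 * b1 + a2 * b0"
    "1 = a1 * b2 + a2 * b1" "1 = a2 * b2"
    using p unfolding fg by (simp_all add: algebra_simps)
  \<comment> \<open>The leading coefficients satisfy \<open>a2 * b2 = 1\<close>, so multiplying
    \<open>f\<close> by \<open>b2\<close> and \<open>g\<close> by \<open>a2\<close> makes both monic
    without changing the product.\<close>
  define s p p' where "s = - (a1 * b2)" and "p = a0 * b2" and "p' = b0 * a2"
  have s': "- 1 - s = - (b1 * a2)"
    using coeffs(4) by (simp add: s_def algebra_simps)
  have "a1 * b2 * (b1 * a2) = a1 * b1 * (a2 * b2)" by (simp add: ac_simps)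
  then have e2: "p + p' + s * (- 1 - s) = u"
    unfolding s' using coeffs(3,5) by (simp add: s_def p_def p'_def algebra_simps)
  have "- (a1 * b2) * (b0 * a2) + - (b1 * a2) * (a0 * b2) = - ((a0 * b1 + a1 * b0) * (a2 * b2))"
    by (simp add: algebra_simps)
  then have e3: "s * p' + (- 1 - s) * p = - v"
    unfolding s' unfolding s_def p_def p'_def coeffs(2) coeffs(5)[symmetric] by simp
  have e4: "p * p' = a"
  proof -
    have "p * p' = a0 * b0 * (a2 * b2)" by (simp add: p_def p'_def ac_simps)
    then show ?thesis using coeffs(1,5) by simp
  qed
  have "(2 * s + 1) * p = s ^ 3 + s\<^sup>2 + u * s + v"
    by (rule factor_const_equation[OF e2 e3])
  then have ne: "2 * s + 1 \<noteq> 0"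
    by (intro two_mult_plus_one_neq_0[OF nondeg]) (rule sym)
  have "p = factor_const u v s"
    by (rule factor_const_unique[OF ne e2 e3])
  moreover have "p' = factor_const u v (- 1 - s)"
  proof (rule factor_const_unique)
    show "2 * (- 1 - s) + 1 \<noteq> 0" by (rule complementary_sum_neq[OF ne])
    show "p' + p + (- 1 - s) * (- 1 - (- 1 - s)) = u" using e2 by (simp add: ac_simps)
    show "(- 1 - s) * p + (- 1 - (- 1 - s)) * p' = - v" using e3 by (simp add: ac_simps)
  qed
  ultimately show False
    using unfactorable ne e4 by (auto simp: unfactorable_quartic_def)
qed simp

text \<open>Reflection is multiplicative and preserves degrees when constant terms are nonzero, a
  property that factors inherit. A proper factorization of \<open>p\<close> would therefore reflect
  to a proper one.\<close>

lemma irreducible_if_reflect_poly: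
  fixes p :: "'a::field poly"
  assumes "coeff p 0 \<noteq> 0" and irred: "irreducible (reflect_poly p)"
  shows "irreducible p"
proof (rule irreducible_polyI)
  have "\<not> reflect_poly p dvd 1" "reflect_poly p \<noteq> 0" using irred by (auto simp: irreducible_def)
  then show "degree p > 0" using assms(1) by (auto simp: is_unit_iff_degree)
  fix a b assume p: "p = a * b" and pos: "degree a > 0" "degree b > 0"
  then have ne: "coeff a 0 \<noteq> 0" "coeff b 0 \<noteq> 0" using assms(1) by (auto simp: coeff_mult)
  have "reflect_poly a dvd 1 \<or> reflect_poly b dvd 1"
    using irred by (intro irreducibleD) (simp_all add: p reflect_poly_mult)
  moreover have "reflect_poly a \<noteq> 0" "reflect_poly b \<noteq> 0" using ne by auto
  ultimately show False using ne pos by (auto simp: is_unit_iff_degree)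
qed

text \<open>The substitution of dX for X is inverted by that of X / d, so a proper factorization
  would transport back to \<open>p\<close>.\<close>

lemma irreducible_smult_pcompose_scale:
  fixes p :: "'a::field poly"
  assumes irred: "irreducible p" and "c \<noteq> 0" "d \<noteq> 0"
  shows "irreducible (smult c (pcompose p [:0, d:]))"
proof (rule irreducible_polyI)
  have "\<not> p dvd 1" "p \<noteq> 0" using irred by (auto simp: irreducible_def)
  then show "degree (smult c (pcompose p [:0, d:])) > 0"
    using assms by (auto simp: is_unit_iff_degree degree_pcompose)
  fix a b assume ab: "smult c (pcompose p [:0, d:]) = a * b" and pos: "degree a > 0" "degree b > 0"
  let ?inv = "[:0, inverse d:]"
  have "pcompose (pcompose p [:0, d:]) ?inv = p"
    using assms by (simp add: pcompose_assoc[symmetric] pcompose_pCons)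
  then have "p = smult (inverse c) (pcompose (smult c (pcompose p [:0, d:])) ?inv)"
    using assms by (simp add: pcompose_smult)
  also have "\<dots> = smult (inverse c) (pcompose a ?inv) * pcompose b ?inv"
    unfolding ab by (simp add: pcompose_mult)
  finally have "smult (inverse c) (pcompose a ?inv) dvd 1 \<or> pcompose b ?inv dvd 1"
    by (rule irreducibleD[OF irred])
  moreover have "degree (smult (inverse c) (pcompose a ?inv)) > 0" "degree (pcompose b ?inv) > 0"
    using assms pos by (auto simp: degree_pcompose)
  moreover from this have "smult (inverse c) (pcompose a ?inv) \<noteq> 0" "pcompose b ?inv \<noteq> 0"
    by force+
  ultimately show False by (auto simp: is_unit_iff_degree)
qed

section \<open>Sequences, their coefficients and scalings\<close>

definition seq_of_coeffs :: "'a::finite_field \<times> 'a \<times> 'a \<times> 'a \<times> 'a \<Rightarrow> 'a poly list" where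
  "seq_of_coeffs = (\<lambda>(c0, c1, c2, c3, c4).
     [[:c0, c1:], [:c0, c1, c2:], [:c0, c1, c2, c3:], [:c0, c1, c2, c3, c4:]])"

lemma atLeastAtMost_1_4: "{1..4} = {1, 2, 3, 4 :: nat}"
  by auto

lemma sum_monom_eq_pCons:
  "(\<Sum>i=0..1. monom (w i) i) = [:w 0, w 1:]"
  "(\<Sum>i=0..2. monom (w i) i) = [:w 0, w 1, w 2:]"
  "(\<Sum>i=0..3. monom (w i) i) = [:w 0, w 1, w 2, w 3:]"
  "(\<Sum>i=0..4. monom (w i) i) = [:w 0, w 1, w 2, w 3, w 4:]"
  by (simp_all add: numeral_eq_Suc monom_Suc monom_0)

text \<open>This makes the set of sequences finite; the cardinality of an infinite set would be 0
  and could not be bounded below by a subset.\<close>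

lemma seq_of_coeffs_range:
  assumes "consecutive_irreducible_seq 4 fs"
  shows "fs \<in> range seq_of_coeffs"
proof -
  obtain w where w: "\<And>n. n \<in> {1..4} \<Longrightarrow> fs ! (n - 1) = (\<Sum>i=0..n. monom (w i) i)"
    and len: "length fs = 4"
    using assms by (auto simp: consecutive_irreducible_seq_def)
  have "fs ! 0 = [:w 0, w 1:]" "fs ! 1 = [:w 0, w 1, w 2:]"
    "fs ! 2 = [:w 0, w 1, w 2, w 3:]" "fs ! 3 = [:w 0, w 1, w 2, w 3, w 4:]"
    using w[of 1, unfolded sum_monom_eq_pCons] w[of 2, unfolded sum_monom_eq_pCons]
      w[of 3, unfolded sum_monom_eq_pCons] w[of 4, unfolded sum_monom_eq_pCons] by simp_all
  then have "fs = seq_of_coeffs (w 0, w 1, w 2, w 3, w 4)"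
    using len unfolding seq_of_coeffs_def
    by (auto simp: list_eq_iff_nth_eq less_Suc_eq numeral_eq_Suc)
  then show ?thesis by blast
qed

lemma consecutive_irreducible_seqI:
  assumes nz: "c0 \<noteq> 0" "c1 \<noteq> 0" "c2 \<noteq> 0" "c3 \<noteq> 0" "c4 \<noteq> 0"
    and irred: "\<forall>f\<in>set (seq_of_coeffs (c0, c1, c2, c3, c4)). irreducible f"
  shows "consecutive_irreducible_seq 4 (seq_of_coeffs (c0, c1, c2, c3, c4))"
  unfolding consecutive_irreducible_seq_def
proof (intro conjI)
  let ?fs = "seq_of_coeffs (c0, c1, c2, c3, c4)"
  show len: "length ?fs = 4" by (simp add: seq_of_coeffs_def)
  show "\<exists>w. (\<forall>i\<in>{0..4}. w i \<noteq> 0) \<and> (\<forall>n\<in>{1..4}. ?fs ! (n - 1) = (\<Sum>i=0..n. monom (w i) i))"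
  proof (intro exI conjI)
    let ?w = "\<lambda>i. [c0, c1, c2, c3, c4] ! i"
    have "{0..4} = {0, 1, 2, 3, 4 :: nat}" by auto
    then show "\<forall>i\<in>{0..4}. ?w i \<noteq> 0" using nz by simp
    show "\<forall>n\<in>{1..4}. ?fs ! (n - 1) = (\<Sum>i=0..n. monom (?w i) i)"
      unfolding atLeastAtMost_1_4 ball_simps sum_monom_eq_pCons[of ?w]
      by (simp add: seq_of_coeffs_def)
  qed
  show "\<forall>n\<in>{1..4}. irreducible (?fs ! (n - 1))"
    using irred len by auto
qed

text \<open>The coefficients of c h(dX) for h = 1 + X + u X^2 + v X^3 + a X^4. The first two entries
  \<open>c\<close> and \<open>c * d\<close> determine the scaling, which makes the parametrization
  injective.\<close>

definition scaled_coeffs :: "('a::finite_field \<times> 'a) \<times> 'a \<times> 'a \<times> 'a \<Rightarrow> 'a \<times> 'a \<times> 'a \<times> 'a \<times> 'a" where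
  "scaled_coeffs = (\<lambda>((c, d), (u, v, a)). (c, c * d, c * d ^ 2 * u, c * d ^ 3 * v, c * d ^ 4 * a))"

lemma inj_on_seq_of_scaled_coeffs:
  "inj_on (\<lambda>x. seq_of_coeffs (scaled_coeffs x)) (((UNIV - {0}) \<times> (UNIV - {0})) \<times> A)"
  by (rule inj_onI) (auto simp: seq_of_coeffs_def scaled_coeffs_def)

lemma consecutive_irreducible_seq_scaled_coeffs:
  fixes c d u v a :: "'a::finite_field"
  assumes two: "(2::'a) \<noteq> 0" and cd: "c \<noteq> 0" "d \<noteq> 0" and triple: "(u, v, a) \<in> normalized_triples"
  shows "consecutive_irreducible_seq 4 (seq_of_coeffs (scaled_coeffs ((c, d), (u, v, a))))"
proof -
  have nonsquare: "quad_char (1 - 4 * u) = - 1" and cubic: "\<And>x. x ^ 3 + x\<^sup>2 + u * x + v \<noteq> 0"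
    and nondeg: "8 * v - 4 * u + 1 \<noteq> 0" and quartic: "unfactorable_quartic u v a"
    using triple by (auto simp: normalized_triples_def base_pairs_def)
  have quadratic: "x\<^sup>2 + x + u \<noteq> 0" for x
  proof
    assume x: "x\<^sup>2 + x + u = 0"
    have "(2 * x + 1)\<^sup>2 = 4 * (x\<^sup>2 + x + u) + (1 - 4 * u)"
      by (simp add: algebra_simps power2_eq_square)
    then have sq: "(2 * x + 1)\<^sup>2 = 1 - 4 * u" using x by simp
    have "quad_char ((2 * x + 1)\<^sup>2) \<noteq> - 1"
      using quad_char_square[of "2 * x + 1"] by (cases "2 * x + 1 = 0") auto
    then show False using nonsquare unfolding sq by simp
  qed
  \<comment> \<open>The coefficients must be nonzero both for the definition of a sequence and for
    reversal to preserve degrees; they are, since 0 is not a root of the reversed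
    polynomials.\<close>
  have u: "u \<noteq> 0" using quadratic[of 0] by simp
  have v: "v \<noteq> 0" using cubic[of 0] by simp
  have a: "a \<noteq> 0" using quartic unfolding unfactorable_quartic_def by (auto dest: spec[of _ 0])
  have "irreducible [:u, 1, 1:]"
    by (rule irreducible_degree_le_3I) (use quadratic in \<open>auto simp: algebra_simps power2_eq_square\<close>)
  moreover have "reflect_poly [:1, 1, u:] = [:u, 1, 1:]" using u by (simp add: reflect_poly_pCons)
  ultimately have f2: "irreducible [:1, 1, u:]"
    using irreducible_if_reflect_poly[where p = "[:1, 1, u:]"] by simp
  have "irreducible [:v, u, 1, 1:]"
    by (rule irreducible_degree_le_3I)
      (use cubic in \<open>auto simp: algebra_simps power2_eq_square power3_eq_cube\<close>)
  moreover have "reflect_poly [:1, 1, u, v:] = [:v, u, 1, 1:]" using v by (simp add: reflect_poly_pCons)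
  ultimately have f3: "irreducible [:1, 1, u, v:]"
    using irreducible_if_reflect_poly[where p = "[:1, 1, u, v:]"] by simp
  have "irreducible [:a, v, u, 1, 1:]"
    by (rule irreducible_quarticI[OF nondeg quartic])
  moreover have "reflect_poly [:1, 1, u, v, a:] = [:a, v, u, 1, 1:]" using a by (simp add: reflect_poly_pCons)
  ultimately have f4: "irreducible [:1, 1, u, v, a:]"
    using irreducible_if_reflect_poly[where p = "[:1, 1, u, v, a:]"] by simp
  have f1: "irreducible [:1, 1::'a:]"
    by (rule irreducible_linear_field_poly) simp
  have scaled: "seq_of_coeffs (scaled_coeffs ((c, d), (u, v, a)))
    = map (\<lambda>f. smult c (pcompose f [:0, d:])) [[:1, 1:], [:1, 1, u:], [:1, 1, u, v:], [:1, 1, u, v, a:]]"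
    by (simp add: seq_of_coeffs_def scaled_coeffs_def pcompose_pCons power2_eq_square
        power3_eq_cube power4_eq_xxxx ac_simps)
  have "\<forall>f\<in>set (seq_of_coeffs (scaled_coeffs ((c, d), (u, v, a)))). irreducible f"
    unfolding scaled using f1 f2 f3 f4 by (simp add: irreducible_smult_pcompose_scale cd del: pcompose_pCons)
  then show ?thesis
    using cd u v a unfolding scaled_coeffs_def by (simp add: consecutive_irreducible_seqI)
qed

lemma num_consecutive_irreducible_seqs_4_ge:
  assumes two: "(2::'a::finite_field) \<noteq> 0"
  shows "(CARD('a) - 1)\<^sup>2 * card (normalized_triples :: ('a \<times> 'a \<times> 'a) set)
    \<le> num_consecutive_irreducible_seqs TYPE('a) 4"
proof -
  let ?X = "((UNIV - {0::'a}) \<times> (UNIV - {0::'a})) \<times> (normalized_triples :: ('a \<times> 'a \<times> 'a) set)"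
  let ?C = "{fs :: 'a poly list. consecutive_irreducible_seq 4 fs}"
  have "?C \<subseteq> range seq_of_coeffs"
    using seq_of_coeffs_range by auto
  then have fin: "finite ?C"
    by (rule finite_subset) simp
  have "(CARD('a) - 1)\<^sup>2 * card (normalized_triples :: ('a \<times> 'a \<times> 'a) set) = card ?X"
    by (simp add: card_cartesian_product power2_eq_square card_Diff_singleton)
  also have "\<dots> = card ((\<lambda>x. seq_of_coeffs (scaled_coeffs x)) ` ?X)"
    by (rule card_image[OF inj_on_seq_of_scaled_coeffs, symmetric])
  also have "\<dots> \<le> card ?C"
  proof (intro card_mono[OF fin] image_subsetI)
    fix x assume "x \<in> ?X"
    moreover obtain c d u v a where "x = ((c, d), (u, v, a))" by (metis prod.exhaust)
    ultimately show "seq_of_coeffs (scaled_coeffs x) \<in> ?C"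
      using consecutive_irreducible_seq_scaled_coeffs[OF two, of c d u v a] by simp
  qed
  finally show ?thesis by (simp add: num_consecutive_irreducible_seqs_def)
qed

lemma of_nat_prime_neq_0:
  assumes "prime p" "CHAR('a::finite_field) \<noteq> p"
  shows "of_nat p \<noteq> (0::'a)"
proof
  assume "of_nat p = (0::'a)"
  then have "CHAR('a) dvd p" by (simp add: of_nat_eq_0_iff_char_dvd)
  moreover have "CHAR('a) \<noteq> 1" by simp
  ultimately show False using assms by (auto simp: prime_nat_iff)
qed

theorem theorem5p6:
  fixes q :: nat
  assumes card_q: "CARD('a::finite_field) = q"
    and char: "CHAR('a) \<noteq> 2" "CHAR('a) \<noteq> 3"
    and q_ge: "q \<ge> 504"
  shows "real (num_consecutive_irreducible_seqs TYPE('a) 4) \<ge>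
    1 / 24 * (real q - 1)^2 * (real q - 22 * sqrt (real q) - 10) *
    ((real q)^2 - 2 * real q * sqrt (real q) - 18 * real q + 18 * sqrt (real q) + 57)"
proof -
  have two: "(2::'a) \<noteq> 0" using of_nat_prime_neq_0[of 2, where 'a = 'a] char by simp
  have three: "(3::'a) \<noteq> 0" using of_nat_prime_neq_0[of 3, where 'a = 'a] char by simp
  let ?M = "real (card (normalized_triples :: ('a \<times> 'a \<times> 'a) set))"
  let ?R = "(real q - 22 * sqrt (real q) - 10) *
    ((real q)^2 - 2 * real q * sqrt (real q) - 18 * real q + 18 * sqrt (real q) + 57)"
  have "?R \<le> 24 * ?M"
    using card_normalized_triples_ge[OF two three] q_ge by (simp add: card_q)
  then have "1 / 24 * (real q - 1)^2 * ?R \<le> 1 / 24 * (real q - 1)^2 * (24 * ?M)"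
    by (intro mult_left_mono) auto
  also have "\<dots> = real ((q - 1)\<^sup>2 * card (normalized_triples :: ('a \<times> 'a \<times> 'a) set))"
    using q_ge by (simp add: of_nat_diff)
  also have "\<dots> \<le> real (num_consecutive_irreducible_seqs TYPE('a) 4)"
    using num_consecutive_irreducible_seqs_4_ge[OF two] unfolding card_q of_nat_le_iff .
  finally show ?thesis by (simp only: mult.assoc)
qed

end
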